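(* Let $\kappa>-1$ be real and let $\rho>-1$ be a non-integer real number. The functions $\varUpsilon^{\kappa,\rho}_{m,s}:=\bar z^{-s/2}\mathcal{Z}^{\kappa,\rho-s/2}_{m,m+s/2}$, for varying nonnegative integer $m$ and varying integer $s\in\mathbb{Z}$, form an orthogonal complete system in $L^{2,\kappa}_\rho(\mathbb{D})$.
   Context: Let $\mathbb{D}=\{z\in\mathbb{C}:|z|<1\}$ and $\mathbb{D}^*=\mathbb{D}\setminus\{0\}$; $\partial/\partial z$ is the Wirtinger derivative. $L^{2,\kappa}_\rho(\mathbb{D})$ is the Hilbert space of complex-valued functions on $\mathbb{D}$ square integrable with respect to $(1-|z|^2)^\kappa|z|^{2\rho}\,dx\,dy$ ($z=x+iy$). The fractional Zernike functions on $\mathbb{D}^*$ are given by $$\mathcal{Z}^{\kappa,\rho}_{m,n}(z,\bar z)=(-1)^m z^{-\rho}(1-|z|^2)^{-\kappa}\frac{\partial^m}{\partial z^m}\Big(z^{n+\rho}(1-|z|^2)^{\kappa+m}\Big),$$ the powers of $z$ being taken with the same local branch. The same formula is used to define $\mathcal{Z}^{\kappa,\rho-s/2}_{m,m+s/2}$, which gives $\mathcal{Z}^{\kappa,\rho-s/2}_{m,m+s/2}=z^{s/2}\mathcal{Z}^{\kappa,\rho}_{m,m}$; with the branches of $z^{s/2}$ and $\bar z^{-s/2}$ chosen as conjugate-compatible, $\varUpsilon^{\kappa,\rho}_{m,s}$ is the single-valued function $$\varUpsilon^{\kappa,\rho}_{m,s}(z,\bar z)=z^s|z|^{-s}\,\mathcal{Z}^{\kappa,\rho}_{m,m}(z,\bar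 z).$$ "Complete" means that the linear span is dense. *)

theory Defs
  imports "HOL-Analysis.Analysis"
begin

text \<open>The Wirtinger derivative $\partial f/\partial z = \frac12(\partial f/\partial x - i\,\partial f/\partial y)$.\<close>

definition wirtinger :: "(complex \<Rightarrow> complex) \<Rightarrow> complex \<Rightarrow> complex" where
  "wirtinger f z =
     (frechet_derivative f (at z) 1 - \<i> * frechet_derivative f (at z) \<i>) / 2"

text \<open>
  The fractional Zernike function, evaluated at \<open>z\<close>. The argument \<open>L\<close> is a branch of the
  logarithm near \<open>z\<close>, and every power \<open>w\<^sup>a\<close> in the formula is read as \<open>exp (a * L w)\<close>. The second
  index \<open>n\<close> is real because half-integer values occur below.
\<close>

definition zernike ::
  "(complex \<Rightarrow> complex) \<Rightarrow> real \<Rightarrow> real \<Rightarrow> nat \<Rightarrow> real \<Rightarrow> complex \<Rightarrow> complex" where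
  "zernike L \<kappa> \<rho> m n z =
     (-1) ^ m * exp (- of_real \<rho> * L z) * of_real ((1 - (cmod z)\<^sup>2) powr (- \<kappa>)) *
     (wirtinger ^^ m)
       (\<lambda>w. exp (of_real (n + \<rho>) * L w) * of_real ((1 - (cmod w)\<^sup>2) powr (\<kappa> + real m))) z"

text \<open>
  A branch of the logarithm that is holomorphic near the given point \<open>z \<noteq> 0\<close>, also when \<open>z\<close> lies
  on the negative real axis, where \<open>Ln\<close> is discontinuous.
\<close>

definition log_branch :: "complex \<Rightarrow> complex \<Rightarrow> complex" where
  "log_branch z w = Ln z + Ln (w / z)"

text \<open>
  $\bar z^{-s/2}\,\mathcal{Z}^{\kappa,\rho-s/2}_{m,m+s/2}$, where the branch of $\bar z^{-s/2}$ is
  conjugate to the branch used for the powers of $z$. The value at \<open>z = 0\<close> is irrelevant.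
\<close>

definition upsilon :: "real \<Rightarrow> real \<Rightarrow> nat \<Rightarrow> int \<Rightarrow> complex \<Rightarrow> complex" where
  "upsilon \<kappa> \<rho> m s z =
     exp (- of_real (of_int s / 2) * cnj (log_branch z z)) *
     zernike (log_branch z) \<kappa> (\<rho> - of_int s / 2) m (real m + of_int s / 2) z"

lemma log_branch_holomorphic:
  assumes "z \<noteq> 0"
  shows "log_branch z holomorphic_on {w. w / z \<notin> \<real>\<^sub>\<le>\<^sub>0}"
  unfolding log_branch_def using assms by (auto intro!: holomorphic_intros)

lemma exp_log_branch:
  assumes "z \<noteq> 0" "w \<noteq> 0"
  shows "exp (log_branch z w) = w"
  using assms by (simp add: log_branch_def exp_add)

lemma upsilon_eq_zernike:
  assumes "z \<noteq> 0"
  shows "upsilon \<kappa> \<rho> m s z =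
    z powi s * of_real (cmod z powr (- of_int s)) * zernike (log_branch z) \<kappa> \<rho> m (real m) z"
proof -
  have L: "log_branch z z = Ln z"
    using assms by (simp add: log_branch_def)
  have "exp (- of_real (of_int s / 2) * cnj (Ln z)) * exp (of_real (of_int s / 2) * Ln z)
      = exp (of_int s * Ln z) * exp (- of_int s * of_real (Re (Ln z)))"
    unfolding exp_add [symmetric]
    by (rule arg_cong [of _ _ exp]) (simp add: complex_eq_iff algebra_simps)
  also have "exp (of_int s * Ln z) = z powi s"
    using exp_power_int [of "Ln z" s] assms by (simp add: mult.commute)
  also have "exp (- of_int s * of_real (Re (Ln z))) = (of_real (cmod z powr (- of_int s)) :: complex)"
    using assms by (simp add: powr_def exp_of_real [symmetric])
  finally have E: "exp (- of_real (of_int s / 2) * cnj (Ln z)) * exp (of_real (of_int s / 2) * Ln z)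
      = z powi s * (of_real (cmod z powr (- of_int s)) :: complex)" .
  have F: "exp (- of_real (\<rho> - of_int s / 2) * Ln z)
      = exp (of_real (of_int s / 2) * Ln z) * exp (- of_real \<rho> * Ln z)"
    by (simp add: exp_add [symmetric] algebra_simps)
  show ?thesis
    unfolding upsilon_def zernike_def L F E [symmetric] by (simp add: mult_ac)
qed

text \<open>
  Square-integrable functions are not identified almost everywhere, and measurability is with
  respect to Borel sets; every Lebesgue-measurable class has a Borel representative.
\<close>

definition L2_space :: "'a measure \<Rightarrow> ('a \<Rightarrow> complex) set" where
  "L2_space M = {f \<in> borel_measurable M. integrable M (\<lambda>x. (cmod (f x))\<^sup>2)}"

definition L2_inner :: "'a measure \<Rightarrow> ('a \<Rightarrow> complex) \<Rightarrow> ('a \<Rightarrow> complex) \<Rightarrow> complex" where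
  "L2_inner M f g = (LINT x|M. f x * cnj (g x))"

definition L2_norm :: "'a measure \<Rightarrow> ('a \<Rightarrow> complex) \<Rightarrow> real" where
  "L2_norm M f = sqrt (LINT x|M. (cmod (f x))\<^sup>2)"

definition orthogonal_system :: "'a measure \<Rightarrow> ('i \<Rightarrow> 'a \<Rightarrow> complex) \<Rightarrow> bool" where
  "orthogonal_system M e \<longleftrightarrow>
     (\<forall>i. e i \<in> L2_space M \<and> L2_norm M (e i) \<noteq> 0) \<and>
     (\<forall>i j. i \<noteq> j \<longrightarrow> L2_inner M (e i) (e j) = 0)"

definition complete_system :: "'a measure \<Rightarrow> ('i \<Rightarrow> 'a \<Rightarrow> complex) \<Rightarrow> bool" where
  "complete_system M e \<longleftrightarrow>
     (\<forall>i. e i \<in> L2_space M) \<and>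
     (\<forall>f\<in>L2_space M. \<forall>\<epsilon>>0. \<exists>F c. finite F \<and>
        L2_norm M (\<lambda>x. f x - (\<Sum>i\<in>F. c i * e i x)) < \<epsilon>)"

text \<open>The measure $(1-|z|^2)^\kappa |z|^{2\rho}\,dx\,dy$ on the unit disc.\<close>

definition disc_measure :: "real \<Rightarrow> real \<Rightarrow> complex measure" where
  "disc_measure \<kappa> \<rho> =
     density (restrict_space lborel (ball 0 1))
       (\<lambda>z. ennreal ((1 - (cmod z)\<^sup>2) powr \<kappa> * cmod z powr (2 * \<rho>)))"

end

theory Submission
  imports Defs
begin

text \<open>
  Carrying out the derivatives in the definition by the Leibniz rule shows that on the punctured disc
  \[ \varUpsilon^{\kappa,\rho}_{m,s}(z) = (z/|z|)^s\, P_m(|z|^2), \]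
  where $P_m$ is, up to normalization, the Jacobi polynomial of degree $m$ for the weight
  $t^\rho (1-t)^\kappa$ on $(0,1)$. Both the angular and the radial factor are then classical.

  Orthogonality. The measure is invariant under rotations, so the inner product of two functions
  with different $s$ is multiplied by a number different from $1$ under a suitable rotation, and
  vanishes. For equal $s$ the inner product is a radial integral. Lebesgue measure on the disc is
  mapped by $z \mapsto |z|^2$ to $\pi$ times Lebesgue measure on $(0,1)$, so radial integrals of
  polynomials are sums of Beta values. The moments $\int P_m(t)\, t^j\, t^\rho (1-t)^\kappa\,dt$
  become, after cancelling Gamma factors, the $m$-th finite difference of a polynomial of degree
  $j$: they are zero for $j < m$ and positive for $j = m$. The first fact gives
  orthogonality and the second one shows that no function of the system is zero.

  Completeness. The leading coefficient of $P_m$ is positive, so the span of the system contains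
  all $(z/|z|)^s q(|z|^2)$ with a polynomial $q$. Their linear combinations
  are the pullbacks of the polynomial functions along the map $z \mapsto (z/|z|, |z|^2)$ into the compact cylinder
  $S^1 \times [0,1]$. A continuous function on the closed disc pulls back to a continuous function
  on the cylinder, so by Stone--Weierstrass it is a uniform limit of elements of the span; the
  cylinder takes care of the point $0$, where $z/|z|$ has no limit. From continuous functions,
  indicators of closed sets, of Borel sets, then simple functions and finally all square integrable
  functions are reached by dominated convergence and a Dynkin argument. All of this takes place in
  the closure of the span, so that neither orthogonal projections nor Fourier series are involved.
\<close>

section \<open>Iterated Wirtinger derivatives\<close>

lemma wirtinger_eqI:
  assumes "(f has_derivative (\<lambda>h. a * h + b * cnj h)) (at w)"
  shows "wirtinger f w = a"
proof -
  have "frechet_derivative f (at w) = (\<lambda>h. a * h + b * cnj h)"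
    using frechet_derivative_at[OF assms] by simp
  then show ?thesis
    unfolding wirtinger_def by (simp add: algebra_simps)
qed

text \<open>
  The derivative is given in the form \<open>a * h + b * cnj h\<close>, from which the Wirtinger derivative is
  read off as the coefficient \<open>a\<close>.
\<close>
lemma has_derivative_one_minus_norm_sq_powr:
  fixes w :: complex
  assumes "cmod w < 1"
  shows "((\<lambda>w. (of_real ((1 - (cmod w)\<^sup>2) powr d) :: complex)) has_derivative
     (\<lambda>h. - of_real (d * (1 - (cmod w)\<^sup>2) powr (d - 1)) * (cnj w * h + w * cnj h))) (at w)"
proof -
  have pos: "1 - (cmod w)\<^sup>2 > 0"
    using assms by (simp add: power_less_one_iff abs_square_less_1)
  have "((\<lambda>w::complex. 1 - (cmod w)\<^sup>2) has_derivative (\<lambda>h. - (2 * (w \<bullet> h)))) (at w)"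
    unfolding power2_norm_eq_inner
    by (auto intro!: derivative_eq_intros simp: inner_commute)
  from DERIV_compose_FDERIV[OF has_real_derivative_powr[OF pos] this] have "((\<lambda>w. (1 - (cmod w)\<^sup>2) powr d) has_derivative
       (\<lambda>h. - (2 * (w \<bullet> h)) * (d * (1 - (cmod w)\<^sup>2) powr (d - 1)))) (at w)" .
  then have "((\<lambda>w. (of_real ((1 - (cmod w)\<^sup>2) powr d)::complex)) has_derivative
       (\<lambda>h. of_real (- (2 * (w \<bullet> h)) * (d * (1 - (cmod w)\<^sup>2) powr (d - 1))))) (at w)"
    by (rule has_derivative_of_real)
  moreover have h: "cnj w * h + w * cnj h = of_real (2 * (w \<bullet> h))" for h
    by (simp add: complex_eq_iff inner_complex_def algebra_simps)
  ultimately show ?thesis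
    unfolding h by (simp add: mult_ac)
qed

text \<open>
  Each term in the Leibniz expansion has this shape. Differentiating it gives two terms of the same
  shape, since \<open>exp (c * L w) / w = exp ((c - 1) * L w)\<close>; only the coefficient of \<open>h\<close> matters.
\<close>
lemma has_derivative_zernike_term:
  assumes L: "(L has_field_derivative 1 / w) (at w)" and exp: "exp (L w) = w" and w: "cmod w < 1"
  shows "\<exists>b. ((\<lambda>w. exp (of_real c * L w) * of_real ((1 - (cmod w)\<^sup>2) powr d) * cnj w ^ k)
     has_derivative (\<lambda>h. (c * exp (of_real (c - 1) * L w) * of_real ((1 - (cmod w)\<^sup>2) powr d) * cnj w ^ k
        - d * exp (of_real c * L w) * of_real ((1 - (cmod w)\<^sup>2) powr (d - 1)) * cnj w ^ Suc k) * h
        + b * cnj h)) (at w)"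
proof -
  have "w \<noteq> 0" using exp by auto
  have e: "exp (of_real (c - 1) * L w) = exp (of_real c * L w) / w"
    by (simp add: algebra_simps exp_diff exp)
  have "((\<lambda>w. exp (of_real c * L w)) has_field_derivative (c * exp (of_real (c - 1) * L w))) (at w)"
    unfolding e by (auto intro!: derivative_eq_intros L)
  then have 1: "((\<lambda>w. exp (of_real c * L w)) has_derivative (\<lambda>h. (c * exp (of_real (c - 1) * L w)) * h)) (at w)"
    by (simp add: has_field_derivative_def)
  have 2: "((\<lambda>w. cnj w ^ k) has_derivative (\<lambda>h. (of_nat k * cnj w ^ (k - 1)) * cnj h)) (at w)"
    by (auto intro!: derivative_eq_intros bounded_linear.has_derivative[OF bounded_linear_cnj] 
      simp: mult_ac)
  show ?thesis
    by (rule exI[of _ "exp (of_real c * L w) *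
        (of_real ((1 - (cmod w)\<^sup>2) powr d) * (of_nat k * cnj w ^ (k - 1))
         - of_real (d * (1 - (cmod w)\<^sup>2) powr (d - 1)) * w * cnj w ^ k)"],
        rule has_derivative_eq_rhs[OF has_derivative_mult[OF has_derivative_mult[OF 1
          has_derivative_one_minus_norm_sq_powr[OF w]] 2]])
      (simp add: fun_eq_iff algebra_simps)
qed

text \<open>
  The Leibniz formula. With generalized binomial coefficients in place of falling factorials the
  coefficients satisfy \<open>(x - n) * (x gchoose n) = (n + 1) * (x gchoose (n + 1))\<close>, so the two terms
  that arise from the \<open>i\<close>-th one are \<open>i + 1\<close> times the term \<open>i + 1\<close> and \<open>k + 1 - i\<close> times
  the term \<open>i\<close> of the next expansion. Altogether each term occurs with the factor \<open>k + 1\<close>, which is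
  absorbed in the factorial.
\<close>
lemma wirtinger_funpow_zernike:
  fixes a b :: real
  assumes S: "open S" "S \<subseteq> ball 0 1"
    and L: "\<And>w. w \<in> S \<Longrightarrow> (L has_field_derivative 1 / w) (at w)"
    and exp: "\<And>w. w \<in> S \<Longrightarrow> exp (L w) = w"
    and "w \<in> S"
  shows "(wirtinger ^^ k) (\<lambda>w. exp (of_real a * L w) * of_real ((1 - (cmod w)\<^sup>2) powr b)) w
    = fact k * (\<Sum>i\<le>k. of_real ((-1) ^ (k - i) * (a gchoose i) * (b gchoose (k - i))) *
        (exp (of_real (a - i) * L w) * of_real ((1 - (cmod w)\<^sup>2) powr (b - real (k - i))) * cnj w ^ (k - i)))"
  using \<open>w \<in> S\<close>
proof (induction k arbitrary: w)
  case 0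
  then show ?case by simp
next
  case (Suc k)
  let ?c = "\<lambda>k i. (of_real ((-1) ^ (k - i) * (a gchoose i) * (b gchoose (k - i))) :: complex)"
  let ?t = "\<lambda>k i w. exp (of_real (a - i) * L w) * of_real ((1 - (cmod w)\<^sup>2) powr (b - real (k - i))) * cnj w ^ (k - i)"
  have w: "cmod w < 1" using Suc.prems S by auto
  let ?A = "\<lambda>i. of_real (a - i) * exp (of_real (a - i - 1) * L w) * of_real ((1 - (cmod w)\<^sup>2) powr (b - real (k - i))) * cnj w ^ (k - i)
        - of_real (b - real (k - i)) * exp (of_real (a - i) * L w) * of_real ((1 - (cmod w)\<^sup>2) powr (b - real (k - i) - 1)) * cnj w ^ Suc (k - i)"
  have "\<forall>i. \<exists>b. (?t k i has_derivative (\<lambda>h. ?A i * h + b * cnj h)) (at w)"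
    by (intro allI has_derivative_zernike_term L exp Suc.prems w)
  then obtain B where B: "\<And>i. (?t k i has_derivative (\<lambda>h. ?A i * h + B i * cnj h)) (at w)"
    by (auto dest!: choice)
  have "((\<lambda>w. fact k * (\<Sum>i\<le>k. ?c k i * ?t k i w)) has_derivative
     (\<lambda>h. fact k * (\<Sum>i\<le>k. ?c k i * (?A i * h + B i * cnj h)))) (at w)"
    by (intro has_derivative_mult_right has_derivative_sum B)
  also have "(\<lambda>h. fact k * (\<Sum>i\<le>k. ?c k i * (?A i * h + B i * cnj h))) =
    (\<lambda>h. (fact k * (\<Sum>i\<le>k. ?c k i * ?A i)) * h + (fact k * (\<Sum>i\<le>k. ?c k i * B i)) * cnj h)"
    by (rule ext) (simp add: sum_distrib_left sum_distrib_right algebra_simps flip: sum.distrib)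
  finally have "((wirtinger ^^ k) (\<lambda>w. exp (of_real a * L w) * of_real ((1 - (cmod w)\<^sup>2) powr b)) has_derivative
     (\<lambda>h. (fact k * (\<Sum>i\<le>k. ?c k i * ?A i)) * h + (fact k * (\<Sum>i\<le>k. ?c k i * B i)) * cnj h)) (at w)"
    by (rule has_derivative_transform_within_open[OF _ S(1) Suc.prems]) (use Suc.IH in simp)
  then have "(wirtinger ^^ Suc k) (\<lambda>w. exp (of_real a * L w) * of_real ((1 - (cmod w)\<^sup>2) powr b)) w
     = fact k * (\<Sum>i\<le>k. ?c k i * ?A i)"
    by (simp add: wirtinger_eqI)
  also have "(\<Sum>i\<le>k. ?c k i * ?A i) =
     (\<Sum>i\<le>k. of_nat (Suc i) * (?c (Suc k) (Suc i) * ?t (Suc k) (Suc i) w)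
        + of_nat (Suc k - i) * (?c (Suc k) i * ?t (Suc k) i w))"
  proof (rule sum.cong[OF refl])
    fix i assume "i \<in> {..k}"
    then have i: "i \<le> k" by simp
    have g: "(x - of_nat n) * (x gchoose n) = of_nat (Suc n) * (x gchoose Suc n)" for x :: real and n
      using gbinomial_absorption[of n x] gbinomial_absorb_comp[of x n] 
      by (simp add: mult.commute)
    have "(-1) ^ (k - i) * (a gchoose i) * (b gchoose (k - i)) * (a - real i)
        = (-1) ^ (k - i) * (b gchoose (k - i)) * ((a - real i) * (a gchoose i))"
      by (simp only: mult_ac)
    also have "\<dots> = real (Suc i) * ((-1) ^ (Suc k - Suc i) * (a gchoose Suc i) * (b gchoose (Suc k - Suc i)))"
      unfolding g diff_Suc_Suc by (simp only: mult_ac)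
    finally have 1: "?c k i * of_real (a - real i) = of_nat (Suc i) * ?c (Suc k) (Suc i)"
      by (metis of_real_mult of_real_of_nat_eq)
    have "(-1) ^ (k - i) * (a gchoose i) * (b gchoose (k - i)) * - (b - real (k - i))
        = - ((-1) ^ (k - i) * (a gchoose i) * ((b - real (k - i)) * (b gchoose (k - i))))"
      by (simp only: mult_ac mult_minus_right)
    also have "\<dots> = real (Suc k - i) * ((-1) ^ (Suc k - i) * (a gchoose i) * (b gchoose (Suc k - i)))"
      unfolding g Suc_diff_le[OF i] by (simp only: mult_ac power_Suc mult_minus_left mult_minus_right mult_1_left mult_1_right)
    finally have 2: "?c k i * of_real (- (b - real (k - i))) = of_nat (Suc k - i) * ?c (Suc k) i"
      by (metis of_real_mult of_real_of_nat_eq)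
    have "?c k i * ?A i = (?c k i * of_real (a - real i)) * ?t (Suc k) (Suc i) w
        + (?c k i * of_real (- (b - real (k - i)))) * ?t (Suc k) i w"
      using i by (simp add: Suc_diff_le algebra_simps)
    then show "?c k i * ?A i = of_nat (Suc i) * (?c (Suc k) (Suc i) * ?t (Suc k) (Suc i) w)
        + of_nat (Suc k - i) * (?c (Suc k) i * ?t (Suc k) i w)"
      unfolding 1 2 by (simp add: mult.assoc)
  qed
  also have "\<dots> = (\<Sum>i\<le>Suc k. of_nat i * (?c (Suc k) i * ?t (Suc k) i w))
      + (\<Sum>i\<le>Suc k. of_nat (Suc k - i) * (?c (Suc k) i * ?t (Suc k) i w))"
  proof -
    have "(\<Sum>i\<le>k. of_nat (Suc i) * X (Suc i)) = (\<Sum>i\<le>Suc k. of_nat i * X i)"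
      and "(\<Sum>i\<le>k. of_nat (Suc k - i) * X i) = (\<Sum>i\<le>Suc k. of_nat (Suc k - i) * X i)"
      for X :: "nat \<Rightarrow> complex"
      by (subst sum.atMost_Suc_shift) simp_all
    from this[of "\<lambda>i. ?c (Suc k) i * ?t (Suc k) i w"] show ?thesis
      unfolding sum.distrib by (simp only:)
  qed
  also have "\<dots> = (\<Sum>i\<le>Suc k. of_nat (Suc k) * (?c (Suc k) i * ?t (Suc k) i w))"
    unfolding sum.distrib[symmetric] distrib_right[symmetric] of_nat_add[symmetric]
    by (rule sum.cong) simp_all
  finally show ?case
    unfolding sum_distrib_left[symmetric] by (simp only: fact_Suc of_nat_mult mult_ac)
qed

section \<open>Jacobi polynomials\<close>

text \<open>
  The sum is the \<open>m\<close>-th backward difference at \<open>x\<close> of the monic polynomial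
  \<open>\<lambda>x. pochhammer x j\<close> of degree \<open>j\<close>. One difference lowers the degree by one:
  \<open>pochhammer x j - pochhammer (x - 1) j = j * pochhammer x (j - 1)\<close>.
\<close>
lemma alternating_sum_pochhammer:
  fixes x :: "'a :: {comm_ring_1, semiring_char_0}"
  shows "j \<le> m \<Longrightarrow> (\<Sum>i\<le>m. (-1) ^ i * of_nat (m choose i) * pochhammer (x - of_nat i) j)
    = (if j = m then fact m else 0)"
proof (induction m arbitrary: j x)
  case 0
  then show ?case by simp
next
  case (Suc m)
  let ?T = "\<lambda>m j x. \<Sum>i\<le>m. (-1) ^ i * of_nat (m choose i) * pochhammer (x - of_nat i :: 'a) j"
  have pascal: "(\<Sum>i\<le>Suc m. (-1) ^ i * of_nat (Suc m choose i) * f i)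
      = (\<Sum>i\<le>m. (-1) ^ i * of_nat (m choose i) * (f i - f (Suc i)))" for f :: "nat \<Rightarrow> 'a"
  proof -
    have "(\<Sum>i\<le>m. (-1) ^ i * of_nat (m choose i) * f i) = (\<Sum>i\<le>Suc m. (-1) ^ i * of_nat (m choose i) * f i)"
      by (simp add: binomial_eq_0)
    also have "\<dots> = f 0 - (\<Sum>i\<le>m. (-1) ^ i * of_nat (m choose Suc i) * f (Suc i))"
      by (subst sum.atMost_Suc_shift) (simp add: sum_negf)
    finally show ?thesis
      by (subst sum.atMost_Suc_shift) (simp add: binomial_eq_0 sum_negf sum.distrib sum_subtractf algebra_simps)
  qed
  show ?case
  proof (cases j)
    case 0
    then show ?thesis unfolding pascal by simp
  next
    case (Suc j')
    have diff: "pochhammer y (Suc j') - pochhammer (y - 1) (Suc j') = of_nat (Suc j') * pochhammer y j'" for y :: 'a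
      using pochhammer_rec[of "y - 1" j'] pochhammer_Suc[of y j'] by (simp add: algebra_simps)
    have "?T (Suc m) j x = (\<Sum>i\<le>m. (-1) ^ i * of_nat (m choose i) * (of_nat (Suc j') * pochhammer (x - of_nat i) j'))"
      unfolding pascal Suc diff[symmetric] by (simp add: algebra_simps)
    also have "\<dots> = of_nat (Suc j') * ?T m j' x"
      by (simp add: sum_distrib_left mult_ac del: of_nat_Suc)
    finally show ?thesis
      using Suc.IH[of j' x] Suc.prems Suc by simp
  qed
qed

definition jacobi_coeff :: "real \<Rightarrow> real \<Rightarrow> nat \<Rightarrow> nat \<Rightarrow> real" where
  "jacobi_coeff \<kappa> \<rho> m i = fact m * ((real m + \<rho>) gchoose i) * ((\<kappa> + real m) gchoose (m - i))"

text \<open>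
  By the Rodrigues formula this is
  $(-1)^m t^{-\rho}(1-t)^{-\kappa} \frac{d^m}{dt^m}\big(t^{m+\rho}(1-t)^{m+\kappa}\big)$,
  with the derivative expanded by the Leibniz rule.
\<close>
definition jacobi_poly :: "real \<Rightarrow> real \<Rightarrow> nat \<Rightarrow> real poly" where
  "jacobi_poly \<kappa> \<rho> m =
     (\<Sum>i\<le>m. smult ((-1) ^ i * jacobi_coeff \<kappa> \<rho> m i) (monom 1 (m - i) * [:1, -1:] ^ i))"

lemma poly_jacobi_poly:
  "poly (jacobi_poly \<kappa> \<rho> m) t
     = (\<Sum>i\<le>m. (-1) ^ i * jacobi_coeff \<kappa> \<rho> m i * (t ^ (m - i) * (1 - t) ^ i))"
  by (simp add: jacobi_poly_def poly_sum poly_monom poly_power)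

lemma degree_jacobi_poly_le: "degree (jacobi_poly \<kappa> \<rho> m) \<le> m"
  unfolding jacobi_poly_def
proof (intro degree_sum_le)
  fix i assume "i \<in> {..m}"
  have "degree (monom 1 (m - i) * [:1, -1::real:] ^ i) \<le> (m - i) + i"
    by (intro degree_mult_le[THEN order_trans] add_mono degree_monom_le degree_power_le[THEN order_trans]) simp
  then show "degree (smult ((-1) ^ i * jacobi_coeff \<kappa> \<rho> m i) (monom 1 (m - i) * [:1, -1:] ^ i)) \<le> m"
    using degree_smult_le[of "(-1) ^ i * jacobi_coeff \<kappa> \<rho> m i" "monom 1 (m - i) * [:1, -1:] ^ i"] \<open>i \<in> _\<close>
    by simp
qed simp

text \<open>
  In degree \<open>m\<close> the sign \<open>(-1) ^ i\<close> cancels against the leading coefficient of \<open>(1 - t) ^ i\<close>, and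
  what remains is a sum of positive numbers because \<open>\<kappa>\<close> and \<open>\<rho>\<close> exceed \<open>-1\<close>.
\<close>
lemma coeff_jacobi_poly_pos:
  assumes "\<kappa> > -1" "\<rho> > -1"
  shows "coeff (jacobi_poly \<kappa> \<rho> m) m > 0"
proof -
  have pos: "(x gchoose k) > 0" if "x > real k - 1" for x :: real and k
    unfolding gbinomial_prod_rev using that by (intro divide_pos_pos prod_pos) auto
  have c: "jacobi_coeff \<kappa> \<rho> m i > 0" if "i \<le> m" for i
    unfolding jacobi_coeff_def using assms that by (intro mult_pos_pos pos) auto
  have "coeff ([:1, -1::real:] ^ i) i = (-1) ^ i" for i
    using lead_coeff_power[of "[:1, -1::real:]" i] by (simp add: degree_power_eq)
  then have "coeff (jacobi_poly \<kappa> \<rho> m) m = (\<Sum>i\<le>m. jacobi_coeff \<kappa> \<rho> m i)"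
    unfolding jacobi_poly_def
    by (auto simp: coeff_sum coeff_monom_mult mult_ac simp flip: power_mult_distrib intro!: sum.cong)
  also have "\<dots> > 0"
    by (intro sum_pos c) auto
  finally show ?thesis .
qed

text \<open>
  The sum is the \<open>j\<close>-th moment of the Jacobi polynomial for the weight \<open>t powr \<rho> * (1 - t) powr \<kappa>\<close>.
  In Gamma functions, the binomial coefficients and the Beta value combine to a factor that does not
  depend on \<open>i\<close> times \<open>m choose i\<close> times
  \<open>Gamma (m - i + j + \<rho> + 1) / Gamma (m - i + \<rho> + 1)\<close>. The last quotient is a Pochhammer symbol, so
  a finite difference of a polynomial of degree \<open>j\<close> is left.
\<close>
lemma jacobi_Beta_sum:
  assumes "\<kappa> > -1" "\<rho> > -1" "j \<le> m"
  shows "(\<Sum>i\<le>m. (-1) ^ i * jacobi_coeff \<kappa> \<rho> m i * Beta (real (m - i + j) + \<rho> + 1) (real i + \<kappa> + 1))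
    = (if j = m then fact m * Gamma (real m + \<rho> + 1) * Gamma (\<kappa> + real m + 1)
         / Gamma (real (m + j) + \<rho> + \<kappa> + 2) else 0)"
proof -
  let ?C = "Gamma (real m + \<rho> + 1) * Gamma (\<kappa> + real m + 1) / Gamma (real (m + j) + \<rho> + \<kappa> + 2)"
  have "(\<Sum>i\<le>m. (-1) ^ i * jacobi_coeff \<kappa> \<rho> m i * Beta (real (m - i + j) + \<rho> + 1) (real i + \<kappa> + 1))
     = (\<Sum>i\<le>m. ?C * ((-1) ^ i * of_nat (m choose i) * pochhammer (real m + \<rho> + 1 - of_nat i) j))"
  proof (rule sum.cong[OF refl])
    fix i assume "i \<in> {..m}"
    then have i: "i \<le> m" by simp
    have np: "x \<notin> \<int>\<^sub>\<le>\<^sub>0" if "x > 0" for x :: real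
      using that by (auto elim!: nonpos_Ints_cases)
    let ?r = "real (m - i) + \<rho> + 1" and ?k = "real i + \<kappa> + 1"
    have pos: "?r > 0" "?k > 0" using assms by auto
    have 1: "((real m + \<rho>) gchoose i) = Gamma (real m + \<rho> + 1) / (fact i * Gamma ?r)"
      using gbinomial_Gamma[of "real m + \<rho>" i] np[of "real m + \<rho> + 1"] assms i
      by (simp add: of_nat_diff algebra_simps)
    have 2: "((\<kappa> + real m) gchoose (m - i)) = Gamma (\<kappa> + real m + 1) / (fact (m - i) * Gamma ?k)"
      using gbinomial_Gamma[of "\<kappa> + real m" "m - i"] np[of "\<kappa> + real m + 1"] assms i
      by (simp add: of_nat_diff algebra_simps)
    have 3: "Gamma (real (m - i + j) + \<rho> + 1) = pochhammer ?r j * Gamma ?r"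
      using pochhammer_Gamma[OF np[OF pos(1)], of j] Gamma_real_pos[OF pos(1)]
      by (simp add: field_simps)
    have 4: "real (m - i + j) + \<rho> + 1 + ?k = real (m + j) + \<rho> + \<kappa> + 2"
      using i by (simp add: of_nat_diff)
    have 5: "real m + \<rho> + 1 - of_nat i = ?r"
      using i by (simp add: of_nat_diff)
    have 6: "real (m choose i) = fact m / (fact i * fact (m - i))"
      using i by (rule binomial_fact)
    show "(-1) ^ i * jacobi_coeff \<kappa> \<rho> m i * Beta (real (m - i + j) + \<rho> + 1) ?k =
      ?C * ((-1) ^ i * of_nat (m choose i) * pochhammer (real m + \<rho> + 1 - of_nat i) j)"
      unfolding jacobi_coeff_def Beta_def 1 2 3 4 5 6
      using Gamma_real_pos[OF pos(1)] Gamma_real_pos[OF pos(2)] by (simp add: field_simps)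
  qed
  also have "\<dots> = ?C * (if j = m then fact m else 0)"
    unfolding sum_distrib_left[symmetric] alternating_sum_pochhammer[OF assms(3)] ..
  finally show ?thesis by (simp add: mult_ac)
qed

text \<open>
  The powers of \<open>z\<close> outside and inside the derivative combine to \<open>z ^ (m - i)\<close>, which together with
  \<open>cnj z ^ (m - i)\<close> is a power of \<open>(cmod z)\<^sup>2\<close>; this is where the branch disappears.
\<close>
lemma zernike_eq_jacobi_poly:
  assumes z: "z \<noteq> 0" "cmod z < 1"
  shows "zernike (log_branch z) \<kappa> \<rho> m (real m) z = of_real (poly (jacobi_poly \<kappa> \<rho> m) ((cmod z)\<^sup>2))"
proof -
  let ?L = "log_branch z" and ?t = "(cmod z)\<^sup>2"
  \<comment> \<open>The slit disc: the iterated derivative at \<open>z\<close> involves the formula on a neighbourhood of \<open>z\<close>,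
    and the branch is holomorphic off the ray opposite to \<open>z\<close>.\<close>
  define S where "S = {w. w / z \<notin> \<real>\<^sub>\<le>\<^sub>0} \<inter> ball 0 1"
  have S: "open S" "S \<subseteq> ball 0 1"
  proof -
    have "{w. w / z \<notin> \<real>\<^sub>\<le>\<^sub>0} = (\<lambda>w. w / z) -` (- \<real>\<^sub>\<le>\<^sub>0)" by auto
    moreover have "open ((\<lambda>w. w / z) -` (- \<real>\<^sub>\<le>\<^sub>0))"
      using z by (intro continuous_open_vimage continuous_intros) auto
    ultimately show "open S" unfolding S_def by auto
  qed (auto simp: S_def)
  have zS: "z \<in> S" using z by (auto simp: S_def)
  have L: "(?L has_field_derivative 1 / w) (at w)" if "w \<in> S" for w
    unfolding log_branch_def[abs_def] using that z
    by (auto intro!: derivative_eq_intros simp: S_def)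
  have ex: "exp (?L w) = w" if "w \<in> S" for w
  proof -
    have "w \<noteq> 0" using that by (auto simp: S_def)
    with z show ?thesis by (intro exp_log_branch)
  qed
  have t: "1 - ?t > 0" using z by (simp add: abs_square_less_1)
  have zz: "z * cnj z = of_real ?t" by (rule complex_norm_square[symmetric])
  have "zernike ?L \<kappa> \<rho> m (real m) z =
     (-1) ^ m * exp (- of_real \<rho> * ?L z) * of_real ((1 - ?t) powr (- \<kappa>)) * (fact m *
      (\<Sum>i\<le>m. of_real ((-1) ^ (m - i) * ((real m + \<rho>) gchoose i) * ((\<kappa> + real m) gchoose (m - i))) *
        (exp (of_real (real m + \<rho> - i) * ?L z) * of_real ((1 - ?t) powr (\<kappa> + real m - real (m - i))) * cnj z ^ (m - i))))"
    using wirtinger_funpow_zernike[OF S L ex zS, of m "real m + \<rho>" "\<kappa> + real m"]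
    by (simp only: zernike_def)
  also have "\<dots> = (\<Sum>i\<le>m. of_real ((-1) ^ i * jacobi_coeff \<kappa> \<rho> m i * (?t ^ (m - i) * (1 - ?t) ^ i)))"
    unfolding sum_distrib_left
  proof (rule sum.cong[OF refl])
    fix i assume "i \<in> {..m}"
    then have i: "i \<le> m" by simp
    have sg: "(-1) ^ m * (-1) ^ (m - i) = ((-1) ^ i :: complex)"
      using i by (simp add: power_add[symmetric] uminus_power_if)
    have "exp (- of_real \<rho> * ?L z) * exp (of_real (real m + \<rho> - i) * ?L z) = exp (of_nat (m - i) * ?L z)"
      using i by (simp add: exp_add[symmetric] of_nat_diff algebra_simps)
    also have "\<dots> = z ^ (m - i)" by (simp add: exp_of_nat_mult ex[OF zS])
    finally have e: "exp (- of_real \<rho> * ?L z) * exp (of_real (real m + \<rho> - i) * ?L z) = z ^ (m - i)" .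
    have "(1 - ?t) powr (- \<kappa>) * (1 - ?t) powr (\<kappa> + real m - real (m - i)) = (1 - ?t) ^ i"
      using i t by (simp add: powr_add[symmetric] of_nat_diff powr_realpow)
    then have p: "of_real ((1 - ?t) powr (- \<kappa>)) * of_real ((1 - ?t) powr (\<kappa> + real m - real (m - i)))
        = (of_real ((1 - ?t) ^ i) :: complex)"
      by (metis of_real_mult)
    have "(-1) ^ m * exp (- of_real \<rho> * ?L z) * of_real ((1 - ?t) powr (- \<kappa>)) * (fact m *
      (of_real ((-1) ^ (m - i) * ((real m + \<rho>) gchoose i) * ((\<kappa> + real m) gchoose (m - i))) *
        (exp (of_real (real m + \<rho> - i) * ?L z) * of_real ((1 - ?t) powr (\<kappa> + real m - real (m - i))) * cnj z ^ (m - i))))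
      = ((-1) ^ m * (-1) ^ (m - i)) * of_real (jacobi_coeff \<kappa> \<rho> m i)
        * ((exp (- of_real \<rho> * ?L z) * exp (of_real (real m + \<rho> - i) * ?L z)) * cnj z ^ (m - i))
        * (of_real ((1 - ?t) powr (- \<kappa>)) * of_real ((1 - ?t) powr (\<kappa> + real m - real (m - i))))"
      unfolding jacobi_coeff_def by (simp only: of_real_mult of_real_fact of_real_power of_real_minus of_real_1 mult_ac)
    also have "\<dots> = of_real ((-1) ^ i * jacobi_coeff \<kappa> \<rho> m i * (?t ^ (m - i) * (1 - ?t) ^ i))"
      unfolding sg e p power_mult_distrib[symmetric] zz by simp
    finally show "(-1) ^ m * exp (- of_real \<rho> * ?L z) * of_real ((1 - ?t) powr (- \<kappa>)) * (fact m *
      (of_real ((-1) ^ (m - i) * ((real m + \<rho>) gchoose i) * ((\<kappa> + real m) gchoose (m - i))) *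
        (exp (of_real (real m + \<rho> - i) * ?L z) * of_real ((1 - ?t) powr (\<kappa> + real m - real (m - i))) * cnj z ^ (m - i))))
      = of_real ((-1) ^ i * jacobi_coeff \<kappa> \<rho> m i * (?t ^ (m - i) * (1 - ?t) ^ i))" .
  qed
  also have "\<dots> = of_real (poly (jacobi_poly \<kappa> \<rho> m) ?t)"
    unfolding poly_jacobi_poly of_real_sum ..
  finally show ?thesis .
qed

section \<open>Radial integrals over the disc\<close>

text \<open>
  The substitute for polar coordinates. The set where \<open>x < (cmod z)\<^sup>2\<close> is an annulus of area
  \<open>pi * (1 - x)\<close>, and the measures of the half-lines determine a finite measure on the real line.
\<close>
lemma distr_unit_disc_norm_sq:
  "distr (restrict_space lborel (ball 0 1)) borel (\<lambda>z::complex. (cmod z)\<^sup>2)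
     = density lborel (\<lambda>t. ennreal (pi * indicator {0<..<1} t))"  (is "?M = ?N")
proof (rule measure_eqI_lessThan)
  have N: "emeasure ?N {x<..} = ennreal pi * emeasure lborel ({0<..<1} \<inter> {x<..})" for x
  proof -
    have "emeasure ?N {x<..} = (\<integral>\<^sup>+t. ennreal pi * indicator ({0<..<1} \<inter> {x<..}) t \<partial>lborel)"
      by (subst emeasure_density) (auto intro!: nn_integral_cong split: split_indicator)
    then show ?thesis
      by (simp add: nn_integral_cmult)
  qed
  have eq: "emeasure ?M {x<..} = emeasure ?N {x<..}" for x
  proof -
    have [measurable]: "(\<lambda>z::complex. (cmod z)\<^sup>2) \<in> borel_measurable (restrict_space lborel (ball 0 1))"
      by (intro measurable_restrict_space1) simp
    have "(\<lambda>z::complex. (cmod z)\<^sup>2) -` {x<..} \<inter> ball 0 1 = {z \<in> ball 0 1. x < (cmod z)\<^sup>2}"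
      by auto
    then have M: "emeasure ?M {x<..} = emeasure lborel {z \<in> ball 0 1 :: complex set. x < (cmod z)\<^sup>2}"
      by (subst emeasure_distr) (auto simp: emeasure_restrict_space space_restrict_space subset_iff)
    have b1: "emeasure lborel (ball 0 1 :: complex set) = ennreal pi"
      by (simp add: emeasure_ball unit_ball_vol_2)
    consider "x < 0" | "0 \<le> x" "x < 1" | "1 \<le> x" by linarith
    then show ?thesis
    proof cases
      case 1
      then have "{z \<in> ball 0 1 :: complex set. x < (cmod z)\<^sup>2} = ball 0 1"
        by (auto intro: less_le_trans)
      moreover have "{0<..<1} \<inter> {x<..} = {0<..<1}" using 1 by auto
      ultimately show ?thesis unfolding M N by (simp add: b1)
    next
      case 2
      have "x < (cmod z)\<^sup>2 \<longleftrightarrow> sqrt x < cmod z" for z :: complex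
        using real_sqrt_less_iff[of x "(cmod z)\<^sup>2"] by simp
      then have "{z \<in> ball 0 1 :: complex set. x < (cmod z)\<^sup>2} = ball 0 1 - cball 0 (sqrt x)"
        by (simp only: set_eq_iff mem_Collect_eq Diff_iff mem_cball_0 not_le) blast
      moreover have "cball 0 (sqrt x) \<subseteq> (ball 0 1 :: complex set)"
      proof -
        have "sqrt x < 1" using 2 by simp
        from le_less_trans[OF _ this] show ?thesis by auto
      qed
      then have "emeasure lborel (ball 0 1 - cball 0 (sqrt x) :: complex set) = ennreal pi - ennreal (pi * x)"
        using 2 by (subst emeasure_Diff) (auto simp: b1 emeasure_cball unit_ball_vol_2)
      moreover have "{0<..<1} \<inter> {x<..} = {x<..<1}" using 2 by auto
      ultimately show ?thesis unfolding M N using 2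
        by (simp add: ennreal_minus ennreal_mult'[symmetric] algebra_simps)
    next
      case 3
      then have e1: "{z \<in> ball 0 1 :: complex set. x < (cmod z)\<^sup>2} = {}"
        by (auto simp: abs_square_less_1 not_less power_le_one intro: order_trans[of _ 1])
      have e2: "{0<..<1} \<inter> {x<..} = {}" using 3 by auto
      show ?thesis unfolding M N e1 e2 by simp
    qed
  qed
  fix x show "emeasure ?M {x<..} = emeasure ?N {x<..}" by (rule eq)
  have "emeasure lborel ({0<..<1} \<inter> {x<..}) \<le> emeasure lborel {0<..<1::real}"
    by (intro emeasure_mono) auto
  also have "\<dots> < \<infinity>" by simp
  finally show "emeasure ?M {x<..} < \<infinity>"
    unfolding eq N by (simp add: ennreal_mult_less_top)
qed simp_all

lemma space_disc_measure [simp]: "space (disc_measure \<kappa> \<rho>) = ball 0 1"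
  by (simp add: disc_measure_def space_restrict_space)

lemma sets_disc_measure [measurable_cong]: "sets (disc_measure \<kappa> \<rho>) = sets (restrict_space borel (ball 0 1))"
  by (simp add: disc_measure_def cong: sets_restrict_space_cong)

lemma borel_measurable_disc_measureI:
  "f \<in> borel_measurable borel \<Longrightarrow> f \<in> borel_measurable (disc_measure \<kappa> \<rho>)"
  unfolding measurable_cong_sets[OF sets_disc_measure refl] by (rule measurable_restrict_space1)

lemma distr_disc_measure_norm_sq:
  "distr (disc_measure \<kappa> \<rho>) borel (\<lambda>z. (cmod z)\<^sup>2)
     = density lborel (\<lambda>t. ennreal (pi * indicator {0<..<1} t * ((1 - t) powr \<kappa> * t powr \<rho>)))"
proof -
  have "disc_measure \<kappa> \<rho> = density (restrict_space lborel (ball 0 1))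
      (\<lambda>z. ennreal ((1 - (cmod z)\<^sup>2) powr \<kappa> * ((cmod z)\<^sup>2) powr \<rho>))"
    unfolding disc_measure_def using powr_powr[of "cmod _" 2 \<rho>] by simp
  also have "distr \<dots> borel (\<lambda>z. (cmod z)\<^sup>2)
      = density (distr (restrict_space lborel (ball 0 1)) borel (\<lambda>z. (cmod z)\<^sup>2))
          (\<lambda>t. ennreal ((1 - t) powr \<kappa> * t powr \<rho>))"
    by (rule density_distr[symmetric]) (auto intro!: measurable_restrict_space1)
  also have "\<dots> = density lborel (\<lambda>t. ennreal (pi * indicator {0<..<1} t * ((1 - t) powr \<kappa> * t powr \<rho>)))"
    unfolding distr_unit_disc_norm_sq by (subst density_density_eq) (auto simp: ennreal_mult)
  finally show ?thesis .
qed

lemma AE_disc_measure_nonzero: "AE z in disc_measure \<kappa> \<rho>. z \<noteq> 0 \<and> cmod z < 1"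
proof -
  have "AE z in lborel. z \<noteq> (0::complex)"
    by (rule AE_lborel_singleton)
  then have "AE z in restrict_space lborel (ball 0 1). z \<noteq> (0::complex) \<and> cmod z < 1"
    by (subst AE_restrict_space_iff) auto
  then show ?thesis
    unfolding disc_measure_def
    by (subst AE_density) (auto intro!: measurable_restrict_space1)
qed

text \<open>
  All radial polynomials are integrated through these; the monomials in \<open>t\<close> and \<open>1 - t\<close> fit the
  terms of the Jacobi polynomials and make every integral a Beta value.
\<close>
lemma disc_measure_radial_moment:
  assumes "\<kappa> > -1" "\<rho> > -1"
  shows "integrable (disc_measure \<kappa> \<rho>) (\<lambda>z. ((cmod z)\<^sup>2) ^ j * (1 - (cmod z)\<^sup>2) ^ i)"
    and "(LINT z|disc_measure \<kappa> \<rho>. ((cmod z)\<^sup>2) ^ j * (1 - (cmod z)\<^sup>2) ^ i)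
      = pi * Beta (real j + \<rho> + 1) (real i + \<kappa> + 1)"
proof -
  let ?B = "Beta (real j + \<rho> + 1) (real i + \<kappa> + 1)"
  have B: "?B \<ge> 0"
    using assms by (auto simp: Beta_def intro!: divide_nonneg_nonneg mult_nonneg_nonneg Gamma_real_nonneg)
  have [measurable]: "(\<lambda>z. (cmod z)\<^sup>2) \<in> borel_measurable (disc_measure \<kappa> \<rho>)"
    by (intro borel_measurable_disc_measureI) simp
  have "(\<integral>\<^sup>+z. ennreal (((cmod z)\<^sup>2) ^ j * (1 - (cmod z)\<^sup>2) ^ i) \<partial>disc_measure \<kappa> \<rho>)
      = (\<integral>\<^sup>+t. ennreal (t ^ j * (1 - t) ^ i) \<partial>distr (disc_measure \<kappa> \<rho>) borel (\<lambda>z. (cmod z)\<^sup>2))"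
    by (subst nn_integral_distr) auto
  also have "\<dots> = (\<integral>\<^sup>+t. ennreal (pi * indicator {0<..<1} t * ((1 - t) powr \<kappa> * t powr \<rho>)) * ennreal (t ^ j * (1 - t) ^ i) \<partial>lborel)"
    unfolding distr_disc_measure_norm_sq by (subst nn_integral_density) auto
  also have "\<dots> = (\<integral>\<^sup>+t. ennreal (indicator {0<..<1} t * (pi * (t powr (real j + \<rho> + 1 - 1) * (1 - t) powr (real i + \<kappa> + 1 - 1)))) \<partial>lborel)"
  proof (rule nn_integral_cong)
    fix t :: real
    show "ennreal (pi * indicator {0<..<1} t * ((1 - t) powr \<kappa> * t powr \<rho>)) * ennreal (t ^ j * (1 - t) ^ i)
      = ennreal (indicator {0<..<1} t * (pi * (t powr (real j + \<rho> + 1 - 1) * (1 - t) powr (real i + \<kappa> + 1 - 1))))"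
      by (auto simp: indicator_def powr_add powr_realpow ennreal_mult'[symmetric] mult_ac)
  qed
  also have "\<dots> = ennreal (pi * ?B)"
  proof (rule nn_integral_has_integral_lebesgue)
    have "((\<lambda>t. t powr (real j + \<rho> + 1 - 1) * (1 - t) powr (real i + \<kappa> + 1 - 1)) has_integral ?B) {0<..<1}"
      using has_integral_Beta_real[of "real j + \<rho> + 1" "real i + \<kappa> + 1"] assms
      by (simp add: has_integral_Icc_iff_Ioo)
    then show "((\<lambda>t. pi * (t powr (real j + \<rho> + 1 - 1) * (1 - t) powr (real i + \<kappa> + 1 - 1))) has_integral pi * ?B) {0<..<1}"
      by (rule has_integral_mult_right)
  qed auto
  finally have "(\<integral>\<^sup>+z. ennreal (((cmod z)\<^sup>2) ^ j * (1 - (cmod z)\<^sup>2) ^ i) \<partial>disc_measure \<kappa> \<rho>) = ennreal (pi * ?B)" .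
  moreover have "AE z in disc_measure \<kappa> \<rho>. 0 \<le> ((cmod z)\<^sup>2) ^ j * (1 - (cmod z)\<^sup>2) ^ i"
    using AE_disc_measure_nonzero by eventually_elim (auto simp: abs_square_le_1)
  ultimately show "integrable (disc_measure \<kappa> \<rho>) (\<lambda>z. ((cmod z)\<^sup>2) ^ j * (1 - (cmod z)\<^sup>2) ^ i)"
    and "(LINT z|disc_measure \<kappa> \<rho>. ((cmod z)\<^sup>2) ^ j * (1 - (cmod z)\<^sup>2) ^ i) = pi * ?B"
    using B by (subst (asm) nn_integral_eq_integrable; simp)+
qed

lemma finite_measure_disc_measure:
  assumes "\<kappa> > -1" "\<rho> > -1"
  shows "finite_measure (disc_measure \<kappa> \<rho>)"
  using disc_measure_radial_moment(1)[OF assms, of 0 0] 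
  by (auto simp: integrable_iff_bounded less_top intro!: finite_measureI)

section \<open>Rotations and angular integrals\<close>

lemma borel_measurable_Complex [measurable]:
  "(\<lambda>(x, y). Complex x y) \<in> borel_measurable (borel \<Otimes>\<^sub>M borel)"
  unfolding borel_prod
  by (intro borel_measurable_continuous_onI) (auto simp: Complex_eq case_prod_unfold intro!: continuous_intros)

text \<open>Iterated integrals over real and imaginary part come from the product structure.\<close>
lemma lborel_complex_eq_distr: "lborel = distr (lborel \<Otimes>\<^sub>M lborel) borel (\<lambda>(x, y). Complex x y)"
proof (rule lborel_eqI)
  fix l u :: complex
  assume le: "\<And>b. b \<in> Basis \<Longrightarrow> l \<bullet> b \<le> u \<bullet> b"
  have "Re l \<le> Re u" "Im l \<le> Im u"
    using le[of 1] le[of \<i>] by (auto simp: Basis_complex_def)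
  moreover have "(\<lambda>(x, y). Complex x y) -` box l u = {Re l<..<Re u} \<times> {Im l<..<Im u}"
    by (auto simp: box_def Basis_complex_def)
  moreover have "emeasure (lborel \<Otimes>\<^sub>M lborel) ({Re l<..<Re u} \<times> {Im l<..<Im u})
      = emeasure lborel {Re l<..<Re u} * emeasure lborel {Im l<..<Im u}"
    by (intro lborel.emeasure_pair_measure_Times) auto
  ultimately show "emeasure (distr (lborel \<Otimes>\<^sub>M lborel) borel (\<lambda>(x, y). Complex x y)) (box l u)
      = (\<Prod>b\<in>Basis. (u - l) \<bullet> b)"
    by (subst emeasure_distr) (auto simp: space_pair_measure Basis_complex_def ennreal_mult)
qed simp

lemma nn_integral_lborel_complex:
  fixes f :: "complex \<Rightarrow> ennreal"
  assumes [measurable]: "f \<in> borel_measurable borel"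
  shows "(\<integral>\<^sup>+z. f z \<partial>lborel) = (\<integral>\<^sup>+y. \<integral>\<^sup>+x. f (Complex x y) \<partial>lborel \<partial>lborel)"
    and "(\<integral>\<^sup>+z. f z \<partial>lborel) = (\<integral>\<^sup>+x. \<integral>\<^sup>+y. f (Complex x y) \<partial>lborel \<partial>lborel)"
proof -
  note m = borel_measurable_Complex
  have m': "(\<lambda>(x, y). f (Complex x y)) \<in> borel_measurable (lborel \<Otimes>\<^sub>M lborel)"
    using measurable_compose[OF m assms] by (simp add: case_prod_unfold cong: measurable_cong_sets)
  have "(\<integral>\<^sup>+z. f z \<partial>lborel) = (\<integral>\<^sup>+p. (\<lambda>(x, y). f (Complex x y)) p \<partial>(lborel \<Otimes>\<^sub>M lborel))"
    by (subst lborel_complex_eq_distr, subst nn_integral_distr)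
      (use m in \<open>auto simp: case_prod_unfold cong: measurable_cong_sets\<close>)
  then show "(\<integral>\<^sup>+z. f z \<partial>lborel) = (\<integral>\<^sup>+y. \<integral>\<^sup>+x. f (Complex x y) \<partial>lborel \<partial>lborel)"
    and "(\<integral>\<^sup>+z. f z \<partial>lborel) = (\<integral>\<^sup>+x. \<integral>\<^sup>+y. f (Complex x y) \<partial>lborel \<partial>lborel)"
    using lborel_pair.nn_integral_snd[OF m'] lborel.nn_integral_fst[OF m'] by simp_all
qed

text \<open>
  By Fubini, a shear is a translation on each line parallel to one of the axes.
\<close>
lemma nn_integral_shear:
  fixes f :: "complex \<Rightarrow> ennreal" and a :: real
  assumes f [measurable]: "f \<in> borel_measurable borel"
  shows "(\<integral>\<^sup>+z. f (z + of_real (a * Im z)) \<partial>lborel) = (\<integral>\<^sup>+z. f z \<partial>lborel)"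
    and "(\<integral>\<^sup>+z. f (z + \<i> * of_real (a * Re z)) \<partial>lborel) = (\<integral>\<^sup>+z. f z \<partial>lborel)"
proof -
  have tr: "(\<integral>\<^sup>+x. g (x + c) \<partial>lborel) = (\<integral>\<^sup>+x. g x \<partial>lborel)"
    if [measurable]: "g \<in> borel_measurable borel" for g :: "real \<Rightarrow> ennreal" and c
    by (subst (2) lborel_distr_plus[of c, symmetric], subst nn_integral_distr) (auto simp: add.commute)
  have Cm: "(\<lambda>x. Complex x y) \<in> borel_measurable borel" "(\<lambda>x. Complex y x) \<in> borel_measurable borel" for y
    by (auto intro!: borel_measurable_continuous_onI continuous_intros simp: Complex_eq)
  have "(\<integral>\<^sup>+z. f (z + of_real (a * Im z)) \<partial>lborel) = (\<integral>\<^sup>+y. \<integral>\<^sup>+x. f (Complex (x + a * y) y) \<partial>lborel \<partial>lborel)"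
    by (subst nn_integral_lborel_complex(1)) (simp_all add: Complex_eq algebra_simps)
  also have "\<dots> = (\<integral>\<^sup>+y. \<integral>\<^sup>+x. f (Complex x y) \<partial>lborel \<partial>lborel)"
    by (intro nn_integral_cong tr measurable_compose[OF Cm(1) f])
  finally show "(\<integral>\<^sup>+z. f (z + of_real (a * Im z)) \<partial>lborel) = (\<integral>\<^sup>+z. f z \<partial>lborel)"
    by (simp add: nn_integral_lborel_complex(1))
  have "(\<integral>\<^sup>+z. f (z + \<i> * of_real (a * Re z)) \<partial>lborel) = (\<integral>\<^sup>+x. \<integral>\<^sup>+y. f (Complex x (y + a * x)) \<partial>lborel \<partial>lborel)"
    by (subst nn_integral_lborel_complex(2)) (simp_all add: Complex_eq algebra_simps)
  also have "\<dots> = (\<integral>\<^sup>+x. \<integral>\<^sup>+y. f (Complex x y) \<partial>lborel \<partial>lborel)"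
    by (intro nn_integral_cong tr measurable_compose[OF Cm(2) f])
  finally show "(\<integral>\<^sup>+z. f (z + \<i> * of_real (a * Re z)) \<partial>lborel) = (\<integral>\<^sup>+z. f z \<partial>lborel)"
    by (simp add: nn_integral_lborel_complex(2))
qed

text \<open>
  A rotation with matrix \<open>[[a, -b], [b, a]]\<close>, \<open>b \<noteq> 0\<close>, is the product of three shears: a
  horizontal one by \<open>(a - 1) / b\<close>, a vertical one by \<open>b\<close>, and the first one again. Rotations by
  multiples of \<open>pi\<close> are left aside, as one rotation for each frequency suffices below.
\<close>
lemma lborel_distr_rotation:
  assumes c: "cmod c = 1" "Im c \<noteq> 0"
  shows "distr lborel borel (\<lambda>z. c * z) = lborel"
proof (rule measure_eqI)
  fix A assume "A \<in> sets (distr lborel borel (\<lambda>z. c * z))"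
  then have A [measurable]: "A \<in> sets borel" by simp
  define b where "b = (Re c - 1) / Im c"
  let ?f = "indicator A :: complex \<Rightarrow> ennreal"
  let ?S = "\<lambda>z::complex. z + of_real (b * Im z)" and ?T = "\<lambda>z::complex. z + \<i> * of_real (Im c * Re z)"
  have b: "Re c = 1 + b * Im c" using c by (simp add: b_def)
  have "(Re c)\<^sup>2 + (Im c)\<^sup>2 = 1" using c(1) by (metis cmod_power2 one_power2)
  then have "Im c * (b * (2 + b * Im c)) = Im c * - Im c"
    unfolding b by (simp add: power2_eq_square algebra_simps)
  then have b': "b * (2 + b * Im c) = - Im c"
    using mult_left_cancel[OF c(2)] by blast
  have rot: "?S (?T (?S z)) = c * z" for z
  proof (rule complex_eqI)
    have "Re (?S (?T (?S z))) = (1 + b * Im c) * Re z + b * (2 + b * Im c) * Im z"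
      by (simp add: algebra_simps)
    then show "Re (?S (?T (?S z))) = Re (c * z)"
      unfolding b' by (simp add: b)
    show "Im (?S (?T (?S z))) = Im (c * z)"
      by (simp add: b algebra_simps)
  qed
  have "emeasure (distr lborel borel (\<lambda>z. c * z)) A = (\<integral>\<^sup>+z. ?f (c * z) \<partial>lborel)"
    using nn_integral_distr[of "\<lambda>z. c * z" lborel borel ?f] by simp
  also have "\<dots> = (\<integral>\<^sup>+z. ?f (?S (?T (?S z))) \<partial>lborel)"
    by (simp only: rot)
  also have "\<dots> = (\<integral>\<^sup>+z. ?f z \<partial>lborel)"
    using nn_integral_shear(1)[of "\<lambda>z. ?f (?S (?T z))" b] nn_integral_shear(2)[of "\<lambda>z. ?f (?S z)" "Im c"]
      nn_integral_shear(1)[of ?f b] by simp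
  finally show "emeasure (distr lborel borel (\<lambda>z. c * z)) A = emeasure lborel A"
    by simp
qed simp

lemma integral_disc_measure_rotate:
  fixes f :: "complex \<Rightarrow> complex"
  assumes [measurable]: "f \<in> borel_measurable borel" and c: "cmod c = 1" "Im c \<noteq> 0"
  shows "(LINT z|disc_measure \<kappa> \<rho>. f (c * z)) = (LINT z|disc_measure \<kappa> \<rho>. f z)"
proof -
  have [measurable]: "(\<lambda>z::complex. indicator (ball 0 1) z :: real) \<in> borel_measurable borel"
    by (rule borel_measurable_indicator) simp
  let ?w = "\<lambda>z. (1 - (cmod z)\<^sup>2) powr \<kappa> * cmod z powr (2 * \<rho>)"
  have eq: "(LINT z|disc_measure \<kappa> \<rho>. g z) = (LINT z|lborel. indicator (ball 0 1) z *\<^sub>R (?w z *\<^sub>R g z))"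
    if [measurable]: "g \<in> borel_measurable borel" for g :: "complex \<Rightarrow> complex"
    unfolding disc_measure_def
    by (subst integral_density, (intro measurable_restrict_space1; simp)+, simp)
      (simp add: integral_restrict_space)
  have "(LINT z|disc_measure \<kappa> \<rho>. f z) = (LINT z|lborel. indicator (ball 0 1) z *\<^sub>R (?w z *\<^sub>R f z))"
    by (rule eq) simp
  also have "\<dots> = (LINT z|distr lborel borel (\<lambda>z. c * z). indicator (ball 0 1) z *\<^sub>R (?w z *\<^sub>R f z))"
    by (simp only: lborel_distr_rotation[OF c])
  also have "\<dots> = (LINT z|lborel. indicator (ball 0 1) (c * z) *\<^sub>R (?w (c * z) *\<^sub>R f (c * z)))"
    by (rule integral_distr; measurable)
  also have "\<dots> = (LINT z|lborel. indicator (ball 0 1) z *\<^sub>R (?w z *\<^sub>R f (c * z)))"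
    by (simp add: norm_mult c indicator_def)
  also have "\<dots> = (LINT z|disc_measure \<kappa> \<rho>. f (c * z))"
    by (rule eq[symmetric]) simp
  finally show ?thesis ..
qed

text \<open>The value at \<open>0\<close> makes the function unimodular everywhere, so that no exceptions arise in
  identities between its powers.\<close>
definition direction :: "complex \<Rightarrow> complex" where
  "direction z = (if z = 0 then 1 else sgn z)"

lemma norm_direction [simp]: "cmod (direction z) = 1"
  by (simp add: direction_def norm_sgn)

lemma direction_nonzero [simp]: "direction z \<noteq> 0"
  using norm_direction[of z] by force

lemma borel_measurable_direction_powi [measurable]: "(\<lambda>z. direction z powi s) \<in> borel_measurable borel"
proof -
  have [measurable]: "direction \<in> borel_measurable borel"
    unfolding direction_def[abs_def] sgn_div_norm by measurable
  show ?thesis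
    unfolding power_int_def by measurable
qed

text \<open>
  Rotating by the angle \<open>1 / k\<close> multiplies the integrand by \<open>cis 1 \<noteq> 1\<close> without changing the integral.
\<close>
lemma integral_disc_measure_angular:
  assumes [measurable]: "g \<in> borel_measurable borel" and k: "k \<noteq> 0"
  shows "(LINT z|disc_measure \<kappa> \<rho>. direction z powi k * g (cmod z)) = 0"
proof -
  define c where "c = cis (1 / of_int k)"
  have Im: "Im c \<noteq> 0"
  proof -
    have "\<bar>1 / real_of_int k\<bar> \<le> 1" "1 / real_of_int k \<noteq> 0" using k by (auto simp: field_simps)
    then have "sin (1 / real_of_int k) \<noteq> 0"
      using sin_eq_0_pi[of "1 / real_of_int k"] pi_gt3 by linarith
    then show ?thesis by (simp add: c_def)
  qed
  have c: "cmod c = 1" "c powi k = cis 1" using k by (simp_all add: c_def cis_power_int)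
  have "(LINT z|disc_measure \<kappa> \<rho>. direction z powi k * g (cmod z))
    = (LINT z|disc_measure \<kappa> \<rho>. direction (c * z) powi k * g (cmod (c * z)))"
    by (rule integral_disc_measure_rotate[OF _ c(1) Im, symmetric]) simp
  also have "\<dots> = (LINT z|disc_measure \<kappa> \<rho>. cis 1 * (direction z powi k * g (cmod z)))"
  proof (rule integral_cong_AE)
    show "AE z in disc_measure \<kappa> \<rho>. direction (c * z) powi k * g (cmod (c * z)) = cis 1 * (direction z powi k * g (cmod z))"
      using AE_disc_measure_nonzero
    proof eventually_elim
      case (elim z)
      then have "direction (c * z) = c * direction z"
        using c by (auto simp: direction_def sgn_mult) (simp add: sgn_eq)
      then show ?case by (simp add: norm_mult c power_int_mult_distrib)
    qed
  qed (auto intro!: borel_measurable_disc_measureI)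
  also have "\<dots> = cis 1 * (LINT z|disc_measure \<kappa> \<rho>. direction z powi k * g (cmod z))"
    by simp
  finally have "(1 - cis 1) * (LINT z|disc_measure \<kappa> \<rho>. direction z powi k * g (cmod z)) = 0"
    by (simp add: algebra_simps)
  moreover have "cis 1 \<noteq> 1"
    using sin_gt_zero[of 1] pi_gt3 by (auto simp: complex_eq_iff)
  ultimately show ?thesis by simp
qed

section \<open>Closed linear spans of square integrable functions\<close>

lemma norm_add_sq_le: "(cmod (a + b))\<^sup>2 \<le> 2 * (cmod a)\<^sup>2 + 2 * (cmod b)\<^sup>2"
proof -
  have "(cmod (a + b))\<^sup>2 \<le> (cmod a + cmod b)\<^sup>2"
    by (intro power_mono norm_triangle_ineq) auto
  also have "\<dots> \<le> 2 * (cmod a)\<^sup>2 + 2 * (cmod b)\<^sup>2"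
    using sum_squares_bound[of "cmod a" "cmod b"] by (simp add: power2_sum)
  finally show ?thesis .
qed

lemma L2_space_add:
  assumes "f \<in> L2_space M" "g \<in> L2_space M"
  shows "(\<lambda>x. f x + g x) \<in> L2_space M"
proof -
  have [measurable]: "f \<in> borel_measurable M" "g \<in> borel_measurable M"
    and i: "integrable M (\<lambda>x. 2 * (cmod (f x))\<^sup>2 + 2 * (cmod (g x))\<^sup>2)"
    using assms by (auto simp: L2_space_def)
  have "integrable M (\<lambda>x. (cmod (f x + g x))\<^sup>2)"
    by (rule Bochner_Integration.integrable_bound[OF i]) (auto intro: norm_add_sq_le)
  then show ?thesis by (simp add: L2_space_def)
qed

lemma L2_space_scale: "f \<in> L2_space M \<Longrightarrow> (\<lambda>x. a * f x) \<in> L2_space M"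
  by (auto simp: L2_space_def norm_mult power_mult_distrib)

lemma L2_space_diff: "f \<in> L2_space M \<Longrightarrow> g \<in> L2_space M \<Longrightarrow> (\<lambda>x. f x - g x) \<in> L2_space M"
  using L2_space_add[of f M "\<lambda>x. -1 * g x"] L2_space_scale[of g M "-1"] by simp

lemma L2_space_sum:
  "(\<And>i. i \<in> I \<Longrightarrow> f i \<in> L2_space M) \<Longrightarrow> (\<lambda>x. \<Sum>i\<in>I. f i x) \<in> L2_space M"
proof (induction I rule: infinite_finite_induct)
  case (insert i I)
  then show ?case by (simp add: L2_space_add)
qed (simp_all add: L2_space_def)

lemma L2_space_bounded:
  assumes "finite_measure M" "f \<in> borel_measurable M" "AE x in M. cmod (f x) \<le> B"
  shows "f \<in> L2_space M"
proof -
  interpret finite_measure M by fact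
  have "AE x in M. norm ((cmod (f x))\<^sup>2) \<le> B\<^sup>2"
    using assms(3) by eventually_elim (auto intro: power_mono)
  then have "integrable M (\<lambda>x. (cmod (f x))\<^sup>2)"
    using assms(2) by (intro integrable_const_bound[where B = "B\<^sup>2"]) auto
  then show ?thesis using assms by (simp add: L2_space_def)
qed

text \<open>
  A triangle inequality up to constants. It is enough for approximation, and it stays with squared
  norms, so that Minkowski's inequality does not enter.
\<close>
lemma L2_dist_sq_add_le:
  assumes "f \<in> L2_space M" "g \<in> L2_space M"
  shows "(LINT x|M. (cmod (f x + g x))\<^sup>2) \<le> 2 * (LINT x|M. (cmod (f x))\<^sup>2) + 2 * (LINT x|M. (cmod (g x))\<^sup>2)"
proof -
  have "(LINT x|M. (cmod (f x + g x))\<^sup>2) \<le> (LINT x|M. 2 * (cmod (f x))\<^sup>2 + 2 * (cmod (g x))\<^sup>2)"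
    using assms L2_space_add[OF assms]
    by (intro integral_mono) (auto simp: L2_space_def norm_add_sq_le)
  also have "\<dots> = 2 * (LINT x|M. (cmod (f x))\<^sup>2) + 2 * (LINT x|M. (cmod (g x))\<^sup>2)"
    using assms by (subst Bochner_Integration.integral_add) (auto simp: L2_space_def)
  finally show ?thesis .
qed

definition L2_closure :: "'a measure \<Rightarrow> ('i \<Rightarrow> 'a \<Rightarrow> complex) \<Rightarrow> ('a \<Rightarrow> complex) set" where
  "L2_closure M e = {f \<in> L2_space M. \<forall>\<epsilon>>0. \<exists>F c. finite F \<and>
     (LINT x|M. (cmod (f x - (\<Sum>i\<in>F. c i * e i x)))\<^sup>2) < \<epsilon>}"

lemma complete_systemI:
  assumes "\<And>i. e i \<in> L2_space M" "L2_space M \<subseteq> L2_closure M e"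
  shows "complete_system M e"
  unfolding complete_system_def
proof (intro conjI allI ballI impI assms(1))
  fix f and \<epsilon> :: real assume f: "f \<in> L2_space M" and "\<epsilon> > 0"
  have "f \<in> L2_closure M e" "\<epsilon>\<^sup>2 > 0" using f assms(2) \<open>\<epsilon> > 0\<close> by auto
  then obtain F c where F: "finite F" "(LINT x|M. (cmod (f x - (\<Sum>i\<in>F. c i * e i x)))\<^sup>2) < \<epsilon>\<^sup>2"
    unfolding L2_closure_def mem_Collect_eq by meson
  then have "L2_norm M (\<lambda>x. f x - (\<Sum>i\<in>F. c i * e i x)) < \<epsilon>"
    unfolding L2_norm_def using \<open>\<epsilon> > 0\<close> by (intro real_less_lsqrt) auto
  with F show "\<exists>F c. finite F \<and> L2_norm M (\<lambda>x. f x - (\<Sum>i\<in>F. c i * e i x)) < \<epsilon>"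
    by blast
qed

context
  fixes M :: "'a::metric_space measure" and e :: "'i \<Rightarrow> 'a \<Rightarrow> complex"
  assumes e_L2: "\<And>i. e i \<in> L2_space M"
begin

lemma L2_closure_approx:
  assumes "f \<in> L2_space M" "\<And>\<epsilon>. \<epsilon> > 0 \<Longrightarrow> \<exists>g\<in>L2_closure M e. (LINT x|M. (cmod (f x - g x))\<^sup>2) < \<epsilon>"
  shows "f \<in> L2_closure M e"
  unfolding L2_closure_def
proof (intro CollectI conjI allI impI assms(1))
  fix \<epsilon> :: real assume "\<epsilon> > 0"
  then obtain g where g: "g \<in> L2_closure M e" "(LINT x|M. (cmod (f x - g x))\<^sup>2) < \<epsilon> / 4"
    using assms(2)[of "\<epsilon> / 4"] by auto
  obtain F c where F: "finite F" "(LINT x|M. (cmod (g x - (\<Sum>i\<in>F. c i * e i x)))\<^sup>2) < \<epsilon> / 4"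
    using g(1) \<open>\<epsilon> > 0\<close> by (auto simp: L2_closure_def dest!: spec[of _ "\<epsilon> / 4"])
  have gL: "g \<in> L2_space M" using g(1) by (simp add: L2_closure_def)
  have "(LINT x|M. (cmod (f x - (\<Sum>i\<in>F. c i * e i x)))\<^sup>2)
     \<le> 2 * (LINT x|M. (cmod (f x - g x))\<^sup>2) + 2 * (LINT x|M. (cmod (g x - (\<Sum>i\<in>F. c i * e i x)))\<^sup>2)"
    using L2_dist_sq_add_le[OF L2_space_diff[OF assms(1) gL]
        L2_space_diff[OF gL L2_space_sum[of F "\<lambda>i x. c i * e i x" M, OF L2_space_scale[OF e_L2]]]] by simp
  also have "\<dots> < \<epsilon>" using g(2) F(2) by simp
  finally show "\<exists>F c. finite F \<and> (LINT x|M. (cmod (f x - (\<Sum>i\<in>F. c i * e i x)))\<^sup>2) < \<epsilon>"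
    using F(1) by blast
qed

text \<open>
  Nearly every enlargement of the closure below is an instance of this: dominated convergence
  applied to the squared distances.
\<close>
lemma L2_closure_dominated:
  assumes "f \<in> L2_space M" "\<And>n. g n \<in> L2_closure M e"
    and lim: "AE x in M. (\<lambda>n::nat. g n x) \<longlonglongrightarrow> f x"
    and w: "integrable M w" "\<And>n. AE x in M. (cmod (f x - g n x))\<^sup>2 \<le> w x"
  shows "f \<in> L2_closure M e"
proof (rule L2_closure_approx[OF assms(1)])
  fix \<epsilon> :: real assume "\<epsilon> > 0"
  have [measurable]: "f \<in> borel_measurable M" "\<And>n. g n \<in> borel_measurable M"
    using assms(1,2) by (auto simp: L2_closure_def L2_space_def)
  have "(\<lambda>n. LINT x|M. (cmod (f x - g n x))\<^sup>2) \<longlonglongrightarrow> (LINT x|M. 0)"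
  proof (rule integral_dominated_convergence[OF _ _ w(1)])
    show "AE x in M. (\<lambda>n. (cmod (f x - g n x))\<^sup>2) \<longlonglongrightarrow> 0"
      using lim by eventually_elim (auto intro!: tendsto_eq_intros)
  qed (use w(2) in auto)
  then have "\<forall>\<^sub>F n in sequentially. (LINT x|M. (cmod (f x - g n x))\<^sup>2) < \<epsilon>"
    using \<open>\<epsilon> > 0\<close> by (simp add: order_tendstoD(2))
  then show "\<exists>g\<in>L2_closure M e. (LINT x|M. (cmod (f x - g x))\<^sup>2) < \<epsilon>"
    using assms(2) by (auto simp: eventually_sequentially)
qed

lemma L2_closure_base: "e i \<in> L2_closure M e"
  unfolding L2_closure_def using e_L2 by (auto intro!: exI[of _ "{i}"] exI[of _ "\<lambda>_. 1"])

lemma L2_closure_scale: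
  assumes "f \<in> L2_closure M e"
  shows "(\<lambda>x. a * f x) \<in> L2_closure M e"
  unfolding L2_closure_def
proof (intro CollectI conjI allI impI)
  show "(\<lambda>x. a * f x) \<in> L2_space M" using assms by (simp add: L2_closure_def L2_space_scale)
  fix \<epsilon> :: real assume "\<epsilon> > 0"
  then have "\<epsilon> / ((cmod a)\<^sup>2 + 1) > 0" by (intro divide_pos_pos add_nonneg_pos) auto
  then obtain F c where F: "finite F" "(LINT x|M. (cmod (f x - (\<Sum>i\<in>F. c i * e i x)))\<^sup>2) < \<epsilon> / ((cmod a)\<^sup>2 + 1)"
    using assms by (auto simp: L2_closure_def)
  have "(cmod (a * f x - (\<Sum>i\<in>F. a * c i * e i x)))\<^sup>2 = (cmod a)\<^sup>2 * (cmod (f x - (\<Sum>i\<in>F. c i * e i x)))\<^sup>2" for x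
    by (simp add: mult.assoc flip: sum_distrib_left right_diff_distrib norm_mult power_mult_distrib)
  then have "(LINT x|M. (cmod (a * f x - (\<Sum>i\<in>F. a * c i * e i x)))\<^sup>2)
      = (cmod a)\<^sup>2 * (LINT x|M. (cmod (f x - (\<Sum>i\<in>F. c i * e i x)))\<^sup>2)"
    by simp
  also have "\<dots> \<le> ((cmod a)\<^sup>2 + 1) * (LINT x|M. (cmod (f x - (\<Sum>i\<in>F. c i * e i x)))\<^sup>2)"
    by (intro mult_right_mono) auto
  also have "\<dots> < \<epsilon>"
    using F(2) by (simp add: pos_less_divide_eq mult.commute add_nonneg_pos)
  finally show "\<exists>F c. finite F \<and> (LINT x|M. (cmod (a * f x - (\<Sum>i\<in>F. c i * e i x)))\<^sup>2) < \<epsilon>"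
    using F(1) by (intro exI[of _ F] exI[of _ "\<lambda>i. a * c i"] conjI)
qed

lemma L2_closure_add:
  assumes "f \<in> L2_closure M e" "g \<in> L2_closure M e"
  shows "(\<lambda>x. f x + g x) \<in> L2_closure M e"
  unfolding L2_closure_def
proof (intro CollectI conjI allI impI)
  have L: "f \<in> L2_space M" "g \<in> L2_space M" using assms by (auto simp: L2_closure_def)
  show "(\<lambda>x. f x + g x) \<in> L2_space M" using L by (rule L2_space_add)
  fix \<epsilon> :: real assume "\<epsilon> > 0"
  then have "\<epsilon> / 4 > 0" by simp
  then obtain F1 c1 F2 c2 where F1: "finite F1" "(LINT x|M. (cmod (f x - (\<Sum>i\<in>F1. c1 i * e i x)))\<^sup>2) < \<epsilon> / 4"
    and F2: "finite F2" "(LINT x|M. (cmod (g x - (\<Sum>i\<in>F2. c2 i * e i x)))\<^sup>2) < \<epsilon> / 4"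
    using assms unfolding L2_closure_def mem_Collect_eq by meson
  define c where "c i = (if i \<in> F1 then c1 i else 0) + (if i \<in> F2 then c2 i else 0)" for i
  have "(\<Sum>i\<in>F1 \<union> F2. c i * e i x) = (\<Sum>i\<in>F1. c1 i * e i x) + (\<Sum>i\<in>F2. c2 i * e i x)" for x
  proof -
    have "(\<Sum>i\<in>F1 \<union> F2. (if i \<in> F1 then c1 i else 0) * e i x) = (\<Sum>i\<in>F1. c1 i * e i x)"
      "(\<Sum>i\<in>F1 \<union> F2. (if i \<in> F2 then c2 i else 0) * e i x) = (\<Sum>i\<in>F2. c2 i * e i x)"
      using F1(1) F2(1) by (auto intro!: sum.mono_neutral_cong_right)
    then show ?thesis by (simp add: c_def distrib_right sum.distrib)
  qed
  then have "(LINT x|M. (cmod (f x + g x - (\<Sum>i\<in>F1 \<union> F2. c i * e i x)))\<^sup>2)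
     = (LINT x|M. (cmod ((f x - (\<Sum>i\<in>F1. c1 i * e i x)) + (g x - (\<Sum>i\<in>F2. c2 i * e i x))))\<^sup>2)"
    by (simp add: algebra_simps)
  also have "\<dots> \<le> 2 * (LINT x|M. (cmod (f x - (\<Sum>i\<in>F1. c1 i * e i x)))\<^sup>2)
      + 2 * (LINT x|M. (cmod (g x - (\<Sum>i\<in>F2. c2 i * e i x)))\<^sup>2)"
    by (intro L2_dist_sq_add_le L2_space_diff L2_space_sum L2_space_scale e_L2 L)
  also have "\<dots> < \<epsilon>" using F1(2) F2(2) by simp
  finally show "\<exists>F c. finite F \<and> (LINT x|M. (cmod (f x + g x - (\<Sum>i\<in>F. c i * e i x)))\<^sup>2) < \<epsilon>"
    using F1(1) F2(1) by (intro exI[of _ "F1 \<union> F2"] exI[of _ c] conjI finite_UnI)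
qed

lemma L2_closure_diff:
  "f \<in> L2_closure M e \<Longrightarrow> g \<in> L2_closure M e \<Longrightarrow> (\<lambda>x. f x - g x) \<in> L2_closure M e"
  using L2_closure_add[of f "\<lambda>x. -1 * g x"] L2_closure_scale[of g "-1"] by simp

lemma L2_closure_sum:
  assumes "\<And>i. i \<in> I \<Longrightarrow> f i \<in> L2_closure M e"
  shows "(\<lambda>x. \<Sum>i\<in>I. f i x) \<in> L2_closure M e"
proof -
  have "(\<lambda>x. 0) \<in> L2_closure M e"
    using L2_closure_scale[OF L2_closure_base, of 0] by simp
  then show ?thesis
    using assms by (induction I rule: infinite_finite_induct) (auto intro: L2_closure_add)
qed

lemma L2_closure_AE_cong:
  assumes "g \<in> L2_closure M e" "f \<in> borel_measurable M" "AE x in M. f x = g x"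
  shows "f \<in> L2_closure M e"
proof -
  have g: "g \<in> L2_space M" using assms(1) by (simp add: L2_closure_def)
  then have m [measurable]: "g \<in> borel_measurable M" "f \<in> borel_measurable M"
    using assms(2) by (auto simp: L2_space_def)
  have "integrable M (\<lambda>x. (cmod (f x))\<^sup>2) = integrable M (\<lambda>x. (cmod (g x))\<^sup>2)"
    using assms(3) by (intro integrable_cong_AE) auto
  then have "f \<in> L2_space M" using g assms(2) by (simp add: L2_space_def)
  moreover have "(LINT x|M. (cmod (f x - g x))\<^sup>2) = (LINT x|M. 0)"
    using assms(3) by (intro integral_cong_AE) auto
  ultimately show ?thesis
    by (intro L2_closure_approx) (use assms(1) in \<open>auto intro!: bexI[of _ g]\<close>)
qed

text \<open>
  The sets whose indicators lie in the closure form a Dynkin system, hence contain everything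
  generated by \<open>\<C>\<close>. Square integrable functions are then limits of simple functions dominated
  by \<open>2 * cmod (f x)\<close>.
\<close>
lemma L2_closure_eq_L2_space:
  assumes M: "finite_measure M" 
    and closed: "\<And>C. C \<in> \<C> \<Longrightarrow> (\<lambda>x. indicator C x) \<in> L2_closure M e"
    and gen: "sets M = sigma_sets (space M) \<C>" "Int_stable \<C>" "\<C> \<subseteq> Pow (space M)" "space M \<in> \<C>"
  shows "L2_space M \<subseteq> L2_closure M e"
proof
  interpret finite_measure M by fact
  have ind: "(\<lambda>x. indicator A x) \<in> L2_closure M e" if "A \<in> sets M" for A
  proof -
    have "A \<in> sigma_sets (space M) \<C>" using that gen by simp
    with gen(2,3) show ?thesis
    proof (induction rule: sigma_sets_induct_disjoint)
      case (basic A)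
      then show ?case by (rule closed)
    next
      case empty
      show ?case using L2_closure_scale[OF L2_closure_base, of 0] by simp
    next
      case (compl A)
      have A: "A \<in> sets M" using compl gen by simp
      show ?case
        by (rule L2_closure_AE_cong[OF L2_closure_diff[OF closed[OF gen(4)] compl(2)]])
          (use A in \<open>auto simp: indicator_def\<close>)
    next
      case (union A)
      have A [measurable]: "A n \<in> sets M" for n using union gen by auto
      show ?case
      proof (rule L2_closure_dominated[where g = "\<lambda>n x. \<Sum>i<n. indicator (A i) x" and w = "\<lambda>_. 1"])
        show "(\<lambda>x. indicator (\<Union> (range A)) x) \<in> L2_space M"
          by (rule L2_space_bounded[of _ _ 1]) (use M in \<open>auto simp: indicator_def\<close>)
        show "(\<lambda>x. \<Sum>i<n. indicator (A i) x) \<in> L2_closure M e" for n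
          by (rule L2_closure_sum) (use union in auto)
        have eq: "(\<Sum>i<n. indicator (A i) x) = (indicator (\<Union>i<n. A i) x :: complex)" for n x
          by (rule indicator_UN_disjoint[symmetric])
            (use union in \<open>auto simp: disjoint_family_on_def\<close>)
        show "AE x in M. (\<lambda>n. \<Sum>i<n. indicator (A i) x) \<longlonglongrightarrow> (indicator (\<Union> (range A)) x :: complex)"
          unfolding eq by (intro AE_I2 LIMSEQ_indicator_UN)
        show "AE x in M. (cmod (indicator (\<Union> (range A)) x - (\<Sum>i<n. indicator (A i) x)))\<^sup>2 \<le> 1" for n
          unfolding eq by (auto simp: indicator_def)
      qed simp
    qed
  qed
  fix f assume f: "f \<in> L2_space M"
  then have fm: "f \<in> borel_measurable M" by (simp add: L2_space_def)
  obtain s where s: "\<And>i::nat. simple_function M (s i)" "\<And>x. x \<in> space M \<Longrightarrow> (\<lambda>i. s i x) \<longlonglongrightarrow> f x"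
      "\<And>i x. x \<in> space M \<Longrightarrow> dist (s i x) 0 \<le> 2 * dist (f x) 0"
    using borel_measurable_implies_sequence_metric[OF fm, of 0] by blast
  show "f \<in> L2_closure M e"
  proof (rule L2_closure_dominated[OF f, where g = s and w = "\<lambda>x. 9 * (cmod (f x))\<^sup>2"])
    show "s n \<in> L2_closure M e" for n
    proof (rule L2_closure_AE_cong)
      show "(\<lambda>x. \<Sum>y\<in>s n ` space M. y * indicator (s n -` {y} \<inter> space M) x) \<in> L2_closure M e"
        by (intro L2_closure_sum L2_closure_scale ind simple_functionD(2) s)
      show "AE x in M. s n x = (\<Sum>y\<in>s n ` space M. y * indicator (s n -` {y} \<inter> space M) x)"
      proof (intro AE_I2)
        fix x assume "x \<in> space M"
        then have "s n x = (\<Sum>y\<in>s n ` space M. indicator (s n -` {y} \<inter> space M) x *\<^sub>R y)"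
          by (rule simple_function_indicator_representation_banach[OF s(1)])
        also have "\<dots> = (\<Sum>y\<in>s n ` space M. y * indicator (s n -` {y} \<inter> space M) x)"
          by (rule sum.cong) (simp_all add: indicator_def)
        finally show "s n x = (\<Sum>y\<in>s n ` space M. y * indicator (s n -` {y} \<inter> space M) x)" .
      qed
    qed (use s(1) borel_measurable_simple_function in blast)
    show "AE x in M. (\<lambda>n. s n x) \<longlonglongrightarrow> f x" using s(2) by auto
    \<comment> \<open>\<open>cmod (s n x) \<le> 2 * cmod (f x)\<close> bounds the distance by \<open>3 * cmod (f x)\<close>, whence the 9.\<close>
    show "integrable M (\<lambda>x. 9 * (cmod (f x))\<^sup>2)" using f by (simp add: L2_space_def)
    show "AE x in M. (cmod (f x - s n x))\<^sup>2 \<le> 9 * (cmod (f x))\<^sup>2" for n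
    proof (intro AE_I2)
      fix x assume "x \<in> space M"
      then have "cmod (f x - s n x) \<le> 3 * cmod (f x)"
        using norm_triangle_ineq4[of "f x" "s n x"] s(3)[of x n] by simp
      then have "(cmod (f x - s n x))\<^sup>2 \<le> (3 * cmod (f x))\<^sup>2" by (intro power_mono) auto
      then show "(cmod (f x - s n x))\<^sup>2 \<le> 9 * (cmod (f x))\<^sup>2" by (simp add: power_mult_distrib)
    qed
  qed
qed

text \<open>
  The indicator of a nonempty closed set is the limit of the continuous functions
  \<open>max 0 (1 - n * infdist x C)\<close>, and the closed sets are an intersection-stable generator.
\<close>
lemma L2_closure_eq_L2_spaceI_continuous:
  fixes S :: "'a set"
  assumes M: "finite_measure M" "sets M = sets (restrict_space borel S)" and S: "S \<in> sets borel"
    and cont: "\<And>\<phi> :: 'a \<Rightarrow> real. continuous_on UNIV \<phi> \<Longrightarrow> (\<lambda>x. of_real (\<phi> x)) \<in> L2_closure M e"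
  shows "L2_space M \<subseteq> L2_closure M e"
proof (rule L2_closure_eq_L2_space[OF M(1)])
  have sp: "space M = S"
    using sets_eq_imp_space_eq[OF M(2)] by (simp add: space_restrict_space)
  show "sets M = sigma_sets (space M) ((\<inter>) S ` Collect closed)"
    unfolding M(2) sp using S
    by (simp add: sets_restrict_space borel_eq_closed sigma_sets_Int)
  show "Int_stable ((\<inter>) S ` Collect closed)"
    unfolding Int_stable_def
  proof clarify
    fix C D :: "'a set" assume "closed C" "closed D"
    then have "closed (C \<inter> D)" "S \<inter> C \<inter> (S \<inter> D) = S \<inter> (C \<inter> D)" by auto
    then show "S \<inter> C \<inter> (S \<inter> D) \<in> (\<inter>) S ` Collect closed" by blast
  qed
  show "(\<inter>) S ` Collect closed \<subseteq> Pow (space M)" "space M \<in> (\<inter>) S ` Collect closed"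
    unfolding sp by (auto intro!: image_eqI[of _ _ UNIV])
  fix A assume "A \<in> (\<inter>) S ` Collect closed"
  then obtain C where C: "closed C" "A = S \<inter> C" by auto
  have m: "g \<in> borel_measurable borel \<Longrightarrow> g \<in> borel_measurable M" for g :: "'a \<Rightarrow> complex"
    unfolding measurable_cong_sets[OF M(2) refl] by (rule measurable_restrict_space1)
  have ind: "(\<lambda>x. indicator C x) \<in> L2_closure M e"
  proof (cases "C = {}")
    case True
    then show ?thesis using cont[of "\<lambda>_. 0"] by simp
  next
    case False
    let ?\<phi> = "\<lambda>n x. max 0 (1 - real n * infdist x C)"
    show ?thesis
    proof (rule L2_closure_dominated[where g = "\<lambda>n x. of_real (?\<phi> n x)" and w = "\<lambda>_. 1"])
      show "(\<lambda>x. indicator C x) \<in> L2_space M"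
      proof (rule L2_space_bounded[OF M(1) m])
        show "(\<lambda>x. indicator C x :: complex) \<in> borel_measurable borel"
          using C(1) by (intro borel_measurable_indicator borel_closed)
        show "AE x in M. cmod (indicator C x) \<le> 1"
          by (intro AE_I2) (simp add: indicator_def)
      qed
      show "(\<lambda>x. of_real (?\<phi> n x)) \<in> L2_closure M e" for n
        by (intro cont continuous_intros)
      show "AE x in M. (\<lambda>n. of_real (?\<phi> n x)) \<longlonglongrightarrow> (indicator C x :: complex)"
      proof (intro AE_I2)
        fix x :: 'a
        show "(\<lambda>n. of_real (?\<phi> n x)) \<longlonglongrightarrow> (indicator C x :: complex)"
        proof (cases "x \<in> C")
          case True
          then show ?thesis by simp
        next
          case x: False
          then have "infdist x C > 0"
            using C False in_closed_iff_infdist_zero[of C x] infdist_nonneg[of x C] by simp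
          then obtain N where N: "real N * infdist x C > 1"
            using reals_Archimedean3 by blast
          have "?\<phi> n x = 0" if "n \<ge> N" for n
          proof -
            have "real N * infdist x C \<le> real n * infdist x C"
              using that by (intro mult_right_mono) (auto simp: infdist_nonneg)
            with N show ?thesis by simp
          qed
          then show ?thesis
            using x by (intro tendsto_eventually eventually_sequentiallyI[of N]) simp
        qed
      qed
      show "integrable M (\<lambda>_. 1 :: real)"
        using M(1) by (simp add: finite_measure.integrable_const)
      show "AE x in M. (cmod (indicator C x - of_real (?\<phi> n x)))\<^sup>2 \<le> 1" for n
      proof (intro AE_I2)
        fix x
        have p: "0 \<le> ?\<phi> n x" "?\<phi> n x \<le> 1" by (auto simp: infdist_nonneg)
        have "cmod (indicator C x - of_real (?\<phi> n x)) = \<bar>indicator C x - ?\<phi> n x\<bar>"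
          unfolding norm_of_real[symmetric, where 'a = complex] by (simp add: indicator_def)
        also have "\<dots> \<le> 1" using p by (auto simp: indicator_def)
        finally show "(cmod (indicator C x - of_real (?\<phi> n x)))\<^sup>2 \<le> 1"
          by (intro power_le_one) auto
      qed
    qed
  qed
  show "(\<lambda>x. indicator A x) \<in> L2_closure M e"
  proof (rule L2_closure_AE_cong[OF ind m])
    show "(\<lambda>x. indicator A x :: complex) \<in> borel_measurable borel"
      unfolding C(2) using borel_closed[OF C(1)] S by (intro borel_measurable_indicator sets.Int)
    show "AE x in M. indicator A x = (indicator C x :: complex)"
      using sp C(2) by (intro AE_I2) (simp add: indicator_def)
  qed
qed

end

section \<open>Orthogonality\<close>

definition zonal :: "real poly \<Rightarrow> int \<Rightarrow> complex \<Rightarrow> complex" where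
  "zonal q s z = direction z powi s * of_real (poly q ((cmod z)\<^sup>2))"

lemma upsilon_eq_zonal:
  assumes "z \<noteq> 0" "cmod z < 1"
  shows "upsilon \<kappa> \<rho> m s z = zonal (jacobi_poly \<kappa> \<rho> m) s z"
proof -
  have "z powi s * of_real (cmod z powr (- of_int s)) = direction z powi s"
  proof -
    have "cmod z powr (- of_int s) = inverse (cmod z powi s)"
      using assms powr_real_of_int'[of "cmod z" s] by (simp add: powr_minus)
    moreover have "direction z powi s = z powi s / of_real (cmod z) powi s"
      using assms by (simp add: direction_def sgn_eq power_int_divide_distrib)
    ultimately show ?thesis by (simp add: field_simps)
  qed
  then show ?thesis
    unfolding upsilon_eq_zernike[OF assms(1)] zernike_eq_jacobi_poly[OF assms] zonal_def by simp
qed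

lemma borel_measurable_zonal [measurable]: "zonal q s \<in> borel_measurable borel"
proof -
  have "(\<lambda>z::complex. poly q ((cmod z)\<^sup>2)) \<in> borel_measurable borel"
    by (intro borel_measurable_continuous_onI continuous_intros)
  then show ?thesis unfolding zonal_def[abs_def] by measurable
qed

lemma zonal_L2:
  assumes "\<kappa> > -1" "\<rho> > -1"
  shows "zonal q s \<in> L2_space (disc_measure \<kappa> \<rho>)"
proof -
  have "compact ((\<lambda>t. poly q t) ` {0..1})"
    by (intro compact_continuous_image continuous_intros) auto
  from compact_imp_bounded[OF this] obtain B where "\<forall>x\<in>poly q ` {0..1}. norm x \<le> B"
    unfolding bounded_iff by blast
  then have B: "\<bar>poly q t\<bar> \<le> B" if "t \<in> {0..1}" for t
    using that by simp
  have "AE z in disc_measure \<kappa> \<rho>. cmod (zonal q s z) \<le> B"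
    using AE_disc_measure_nonzero
    by eventually_elim (auto simp: zonal_def norm_mult norm_power_int power_le_one intro!: B)
  then show ?thesis
    by (intro L2_space_bounded[OF finite_measure_disc_measure[OF assms]] borel_measurable_disc_measureI) auto
qed

text \<open>The value at \<open>0\<close> is arbitrary; changing a function at one point keeps it measurable.\<close>
lemma upsilon_measurable: "upsilon \<kappa> \<rho> m s \<in> borel_measurable (disc_measure \<kappa> \<rho>)"
proof -
  let ?g = "\<lambda>z. if z = 0 then upsilon \<kappa> \<rho> m s 0 else zonal (jacobi_poly \<kappa> \<rho> m) s z"
  have "?g \<in> borel_measurable (disc_measure \<kappa> \<rho>)"
    by (rule borel_measurable_disc_measureI) measurable
  then show ?thesis
    by (rule measurable_cong[THEN iffD1, rotated]) (auto simp: upsilon_eq_zonal)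
qed

lemma AE_upsilon_eq_zonal:
  "AE z in disc_measure \<kappa> \<rho>. upsilon \<kappa> \<rho> m s z = zonal (jacobi_poly \<kappa> \<rho> m) s z"
  using AE_disc_measure_nonzero by eventually_elim (simp add: upsilon_eq_zonal)

lemma upsilon_L2:
  assumes "\<kappa> > -1" "\<rho> > -1"
  shows "upsilon \<kappa> \<rho> m s \<in> L2_space (disc_measure \<kappa> \<rho>)"
proof -
  have z: "zonal (jacobi_poly \<kappa> \<rho> m) s \<in> L2_space (disc_measure \<kappa> \<rho>)" by (rule zonal_L2[OF assms])
  have "integrable (disc_measure \<kappa> \<rho>) (\<lambda>z. (cmod (upsilon \<kappa> \<rho> m s z))\<^sup>2)
     \<longleftrightarrow> integrable (disc_measure \<kappa> \<rho>) (\<lambda>z. (cmod (zonal (jacobi_poly \<kappa> \<rho> m) s z))\<^sup>2)"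
    using AE_upsilon_eq_zonal[of \<kappa> \<rho> m s] upsilon_measurable[of \<kappa> \<rho> m s] z
    by (intro integrable_cong_AE) (auto simp: L2_space_def)
  with z show ?thesis by (simp add: L2_space_def upsilon_measurable)
qed

lemma jacobi_poly_moment:
  assumes "\<kappa> > -1" "\<rho> > -1"
  shows "(LINT z|disc_measure \<kappa> \<rho>. poly (jacobi_poly \<kappa> \<rho> m) ((cmod z)\<^sup>2) * ((cmod z)\<^sup>2) ^ j)
    = pi * (\<Sum>i\<le>m. (-1) ^ i * jacobi_coeff \<kappa> \<rho> m i * Beta (real (m - i + j) + \<rho> + 1) (real i + \<kappa> + 1))"
proof -
  have "(LINT z|disc_measure \<kappa> \<rho>. poly (jacobi_poly \<kappa> \<rho> m) ((cmod z)\<^sup>2) * ((cmod z)\<^sup>2) ^ j)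
     = (LINT z|disc_measure \<kappa> \<rho>. (\<Sum>i\<le>m. (-1) ^ i * jacobi_coeff \<kappa> \<rho> m i * (((cmod z)\<^sup>2) ^ (m - i + j) * (1 - (cmod z)\<^sup>2) ^ i)))"
    unfolding poly_jacobi_poly sum_distrib_right power_add by (simp only: mult_ac)
  also have "\<dots> = (\<Sum>i\<le>m. (-1) ^ i * jacobi_coeff \<kappa> \<rho> m i * (pi * Beta (real (m - i + j) + \<rho> + 1) (real i + \<kappa> + 1)))"
    by (subst Bochner_Integration.integral_sum)
      (simp_all only: integrable_mult_right disc_measure_radial_moment[OF assms] integral_mult_right_zero)
  finally show ?thesis by (simp only: sum_distrib_left mult_ac)
qed

lemma integrable_poly_norm_sq:
  assumes "\<kappa> > -1" "\<rho> > -1"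
  shows "integrable (disc_measure \<kappa> \<rho>) (\<lambda>z. poly q ((cmod z)\<^sup>2))"
  unfolding poly_altdef
  using disc_measure_radial_moment(1)[OF assms, of _ 0] by (intro Bochner_Integration.integrable_sum integrable_mult_right) simp

lemma jacobi_poly_orthogonal:
  assumes "\<kappa> > -1" "\<rho> > -1" "degree q < m"
  shows "(LINT z|disc_measure \<kappa> \<rho>. poly (jacobi_poly \<kappa> \<rho> m * q) ((cmod z)\<^sup>2)) = 0"
proof -
  have "(LINT z|disc_measure \<kappa> \<rho>. poly (jacobi_poly \<kappa> \<rho> m * q) ((cmod z)\<^sup>2))
    = (LINT z|disc_measure \<kappa> \<rho>. (\<Sum>j\<le>degree q. coeff q j * poly (jacobi_poly \<kappa> \<rho> m * monom 1 j) ((cmod z)\<^sup>2)))"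
    by (simp add: poly_altdef[of q] poly_monom sum_distrib_left mult_ac)
  also have "\<dots> = (\<Sum>j\<le>degree q. coeff q j * (LINT z|disc_measure \<kappa> \<rho>. poly (jacobi_poly \<kappa> \<rho> m * monom 1 j) ((cmod z)\<^sup>2)))"
    by (subst Bochner_Integration.integral_sum) (simp_all only: integrable_mult_right integrable_poly_norm_sq[OF assms(1,2)] integral_mult_right_zero)
  also have "\<dots> = 0"
  proof (intro sum.neutral ballI)
    fix j assume "j \<in> {..degree q}"
    then have "(LINT z|disc_measure \<kappa> \<rho>. poly (jacobi_poly \<kappa> \<rho> m * monom 1 j) ((cmod z)\<^sup>2)) = 0"
      using jacobi_poly_moment[OF assms(1,2), of m j] jacobi_Beta_sum[OF assms(1,2), of j m] assms(3)
      by (simp add: poly_monom)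
    then show "coeff q j * (LINT z|disc_measure \<kappa> \<rho>. poly (jacobi_poly \<kappa> \<rho> m * monom 1 j) ((cmod z)\<^sup>2)) = 0" by simp
  qed
  finally show ?thesis .
qed

text \<open>This keeps the functions of the system from vanishing almost everywhere.\<close>
lemma jacobi_poly_top_moment_pos:
  assumes "\<kappa> > -1" "\<rho> > -1"
  shows "(LINT z|disc_measure \<kappa> \<rho>. poly (jacobi_poly \<kappa> \<rho> m) ((cmod z)\<^sup>2) * ((cmod z)\<^sup>2) ^ m) > 0"
  unfolding jacobi_poly_moment[OF assms] jacobi_Beta_sum[OF assms order.refl]
  using assms by (auto intro!: mult_pos_pos divide_pos_pos Gamma_real_pos)

lemma cnj_direction: "cnj (direction z) = inverse (direction z)"
proof -
  have "direction z * cnj (direction z) = 1"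
    by (simp flip: complex_norm_square)
  then show ?thesis by (rule inverse_unique[symmetric])
qed

lemma L2_inner_upsilon:
  assumes "\<kappa> > -1" "\<rho> > -1" "(m, s) \<noteq> (m', s')"
  shows "L2_inner (disc_measure \<kappa> \<rho>) (upsilon \<kappa> \<rho> m s) (upsilon \<kappa> \<rho> m' s') = 0"
proof -
  let ?M = "disc_measure \<kappa> \<rho>" and ?P = "jacobi_poly \<kappa> \<rho> m * jacobi_poly \<kappa> \<rho> m'"
  have "L2_inner ?M (upsilon \<kappa> \<rho> m s) (upsilon \<kappa> \<rho> m' s')
      = (LINT z|?M. direction z powi (s - s') * of_real (poly ?P ((cmod z)\<^sup>2)))"
    unfolding L2_inner_def
  proof (rule integral_cong_AE)
    have "cnj (direction z powi s') = direction z powi (- s')" for z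
      by (simp add: cnj_direction power_int_minus power_int_inverse)
    then have *: "zonal p s z * cnj (zonal q s' z) = direction z powi (s - s') * of_real (poly (p * q) ((cmod z)\<^sup>2))" for p q z
      by (simp add: zonal_def power_int_add[symmetric] power_int_diff power_int_minus field_simps)
    show "AE z in ?M. upsilon \<kappa> \<rho> m s z * cnj (upsilon \<kappa> \<rho> m' s' z) = direction z powi (s - s') * of_real (poly ?P ((cmod z)\<^sup>2))"
      using AE_upsilon_eq_zonal[of \<kappa> \<rho> m s] AE_upsilon_eq_zonal[of \<kappa> \<rho> m' s']
      by eventually_elim (simp only: *)
    show "(\<lambda>z. upsilon \<kappa> \<rho> m s z * cnj (upsilon \<kappa> \<rho> m' s' z)) \<in> borel_measurable ?M"
    proof -
      have "cnj \<in> borel_measurable borel"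
        by (intro borel_measurable_continuous_onI continuous_intros)
      from measurable_compose[OF upsilon_measurable this] show ?thesis
        by (intro borel_measurable_times upsilon_measurable)
    qed
    show "(\<lambda>z. direction z powi (s - s') * of_real (poly ?P ((cmod z)\<^sup>2))) \<in> borel_measurable ?M"
      using borel_measurable_disc_measureI[OF borel_measurable_zonal[of ?P "s - s'"]] by (simp only: zonal_def[abs_def])
  qed
  also have "\<dots> = 0"
  proof (cases "s = s'")
    case False
    then have "s - s' \<noteq> 0" by simp
    then show ?thesis
      by (rule integral_disc_measure_angular[rotated])
        (intro borel_measurable_continuous_onI continuous_intros)
  next
    case True
    then have "m \<noteq> m'" using assms(3) by simp
    then consider "m' < m" | "m < m'" by linarith
    then have "(LINT z|?M. poly ?P ((cmod z)\<^sup>2)) = 0"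
    proof cases
      case 1
      then show ?thesis
        using jacobi_poly_orthogonal[OF assms(1,2) le_less_trans[OF degree_jacobi_poly_le 1]] by simp
    next
      case 2
      then show ?thesis
        using jacobi_poly_orthogonal[OF assms(1,2) le_less_trans[OF degree_jacobi_poly_le 2]] by (simp add: mult.commute)
    qed
    then show ?thesis using True by (simp del: poly_mult)
  qed
  finally show ?thesis .
qed

lemma L2_norm_upsilon_nonzero:
  assumes "\<kappa> > -1" "\<rho> > -1"
  shows "L2_norm (disc_measure \<kappa> \<rho>) (upsilon \<kappa> \<rho> m s) \<noteq> 0"
proof
  let ?M = "disc_measure \<kappa> \<rho>"
  assume "L2_norm ?M (upsilon \<kappa> \<rho> m s) = 0"
  then have "(LINT z|?M. (cmod (upsilon \<kappa> \<rho> m s z))\<^sup>2) = 0"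
    by (simp add: L2_norm_def)
  then have "AE z in ?M. (cmod (upsilon \<kappa> \<rho> m s z))\<^sup>2 = 0"
    using upsilon_L2[OF assms, of m s] by (subst (asm) integral_nonneg_eq_0_iff_AE) (auto simp: L2_space_def)
  then have "AE z in ?M. poly (jacobi_poly \<kappa> \<rho> m) ((cmod z)\<^sup>2) * ((cmod z)\<^sup>2) ^ m = 0"
    using AE_upsilon_eq_zonal[of \<kappa> \<rho> m s]
    by eventually_elim (auto simp: zonal_def)
  then have "(LINT z|?M. poly (jacobi_poly \<kappa> \<rho> m) ((cmod z)\<^sup>2) * ((cmod z)\<^sup>2) ^ m) = 0"
    by (rule integral_eq_zero_AE)
  then show False using jacobi_poly_top_moment_pos[OF assms, of m] by simp
qed

section \<open>Completeness\<close>

text \<open>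
  The algebra of polynomial functions on the cylinder, pulled back to the disc. It is generated as a
  vector space by the zonal functions; that it absorbs multiplication by polynomials is proved on
  the coordinate functions.
\<close>
inductive_set zonal_span :: "(complex \<Rightarrow> complex) set" where
  zonal: "zonal q s \<in> zonal_span"
| add: "f \<in> zonal_span \<Longrightarrow> g \<in> zonal_span \<Longrightarrow> (\<lambda>z. f z + g z) \<in> zonal_span"
| scale: "f \<in> zonal_span \<Longrightarrow> (\<lambda>z. a * f z) \<in> zonal_span"

text \<open>
  On the unit circle the conjugate of \<open>u\<close> is \<open>inverse u\<close>, so \<open>Re u\<close> and \<open>Im u\<close> are combinations of
  the powers with exponents \<open>1\<close> and \<open>-1\<close>.
\<close>
lemma zonal_span_times_linear:
  assumes "f \<in> zonal_span"
  shows "(\<lambda>z. of_real (Re (direction z)) * f z) \<in> zonal_span"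
    and "(\<lambda>z. of_real (Im (direction z)) * f z) \<in> zonal_span"
    and "(\<lambda>z. of_real ((cmod z)\<^sup>2) * f z) \<in> zonal_span"
proof -
  have up: "(\<lambda>z. direction z powi k * f z) \<in> zonal_span" for k
    using assms
  proof induction
    case (zonal q s)
    have "(\<lambda>z. direction z powi k * zonal q s z) = zonal q (k + s)"
      by (simp add: fun_eq_iff zonal_def power_int_add)
    then show ?case by (simp add: zonal_span.zonal)
  next
    case (add f g)
    then show ?case using zonal_span.add by (fastforce simp: distrib_left)
  next
    case (scale f a)
    then show ?case using zonal_span.scale[OF scale.IH, of a] by (simp add: mult_ac)
  qed
  have inv: "cnj (direction z) = direction z powi (-1)" for z
    by (simp add: power_int_minus cnj_direction)
  have re: "of_real (Re (direction z)) * f z = (1/2) * (direction z powi 1 * f z + direction z powi (-1) * f z)" for z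
    unfolding inv[symmetric] by (simp add: complex_eq_iff field_simps)
  show "(\<lambda>z. of_real (Re (direction z)) * f z) \<in> zonal_span"
    unfolding re by (intro zonal_span.scale zonal_span.add up)
  have im: "of_real (Im (direction z)) * f z = (- \<i>/2) * (direction z powi 1 * f z + (- 1) * (direction z powi (-1) * f z))" for z
    unfolding inv[symmetric] by (simp add: complex_eq_iff field_simps)
  show "(\<lambda>z. of_real (Im (direction z)) * f z) \<in> zonal_span"
    unfolding im by (intro zonal_span.scale zonal_span.add up)
  show "(\<lambda>z. of_real ((cmod z)\<^sup>2) * f z) \<in> zonal_span"
    using assms
  proof induction
    case (zonal q s)
    have "(\<lambda>z. of_real ((cmod z)\<^sup>2) * zonal q s z) = zonal ([:0, 1:] * q) s"
      by (simp add: fun_eq_iff zonal_def mult_ac)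
    then show ?case by (simp add: zonal_span.zonal)
  next
    case (add f g)
    then show ?case using zonal_span.add by (fastforce simp: distrib_left)
  next
    case (scale f a)
    then show ?case using zonal_span.scale[OF scale.IH, of a] by (simp add: mult_ac)
  qed
qed

lemma zonal_span_times_polynomial:
  assumes "real_polynomial_function (p :: complex \<times> real \<Rightarrow> real)" "f \<in> zonal_span"
  shows "(\<lambda>z. of_real (p (direction z, (cmod z)\<^sup>2)) * f z) \<in> zonal_span"
  using assms
proof (induction arbitrary: f rule: real_polynomial_function.induct)
  case (linear p)
  interpret p: bounded_linear p by fact
  have p: "p (u, t) = Re u * p (1, 0) + (Im u * p (\<i>, 0) + t * p (0, 1))" for u t
  proof -
    have "(u, t) = Re u *\<^sub>R (1, 0) + (Im u *\<^sub>R (\<i>, 0) + t *\<^sub>R (0, 1))"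
      by (simp add: complex_eq_iff)
    then show ?thesis by (metis p.add p.scaleR real_scaleR_def)
  qed
  have eq: "of_real (p (direction z, (cmod z)\<^sup>2)) * f z = of_real (p (1, 0)) * (of_real (Re (direction z)) * f z)
      + (of_real (p (\<i>, 0)) * (of_real (Im (direction z)) * f z) + of_real (p (0, 1)) * (of_real ((cmod z)\<^sup>2) * f z))" for z
    unfolding p[of "direction z"] by (simp add: algebra_simps)
  show ?case
    unfolding eq by (intro zonal_span.add zonal_span.scale zonal_span_times_linear linear.prems)
next
  case (const c)
  then show ?case by (rule zonal_span.scale)
next
  case (add p q)
  then show ?case
    using zonal_span.add[OF add.IH(1)[OF add.prems] add.IH(2)[OF add.prems]] by (simp add: distrib_right)
next
  case (mult p q)
  then show ?case
    using mult.IH(1)[OF mult.IH(2)[OF mult.prems]] by (simp add: mult.assoc)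
qed

context
  fixes \<kappa> \<rho> :: real
  assumes \<kappa>: "\<kappa> > -1" and \<rho>: "\<rho> > -1"
begin

abbreviation (input) "fam \<equiv> \<lambda>(m::nat, s::int). upsilon \<kappa> \<rho> m s"

lemma fam_L2: "fam i \<in> L2_space (disc_measure \<kappa> \<rho>)"
  by (cases i) (simp add: upsilon_L2[OF \<kappa> \<rho>])

text \<open>
  Subtracting a multiple of the Jacobi polynomial of the same degree removes the leading term, so
  induction on the degree reaches every polynomial.
\<close>
lemma zonal_in_L2_closure: "zonal q s \<in> L2_closure (disc_measure \<kappa> \<rho>) fam"
proof -
  have "degree q < n \<Longrightarrow> zonal q s \<in> L2_closure (disc_measure \<kappa> \<rho>) fam" for n
  proof (induction n arbitrary: q)
    case (Suc m)
    let ?P = "jacobi_poly \<kappa> \<rho> m"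
    have P: "zonal ?P s \<in> L2_closure (disc_measure \<kappa> \<rho>) fam"
    proof (rule L2_closure_AE_cong[OF fam_L2])
      show "fam (m, s) \<in> L2_closure (disc_measure \<kappa> \<rho>) fam"
        by (rule L2_closure_base[OF fam_L2])
      show "AE z in disc_measure \<kappa> \<rho>. zonal ?P s z = fam (m, s) z"
        using AE_upsilon_eq_zonal[of \<kappa> \<rho> m s] by eventually_elim simp
    qed (intro borel_measurable_disc_measureI borel_measurable_zonal)
    define a where "a = coeff q m / coeff ?P m"
    define r where "r = q - smult a ?P"
    have "coeff r m = 0"
      using coeff_jacobi_poly_pos[OF \<kappa> \<rho>, of m] by (simp add: r_def a_def)
    moreover have "degree r \<le> m"
      unfolding r_def using Suc.prems degree_jacobi_poly_le[of \<kappa> \<rho> m]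
      by (intro degree_diff_le) (auto intro: order_trans[OF degree_smult_le])
    ultimately have "r = 0 \<or> degree r < m"
      by (metis le_neq_implies_less leading_coeff_0_iff)
    then have "zonal r s \<in> L2_closure (disc_measure \<kappa> \<rho>) fam"
    proof
      assume "r = 0"
      then have "zonal r s = (\<lambda>z. 0 * zonal ?P s z)" by (simp add: fun_eq_iff zonal_def)
      then show ?thesis using L2_closure_scale[OF fam_L2 P, of 0] by simp
    qed (rule Suc.IH)
    from L2_closure_add[OF fam_L2 this L2_closure_scale[OF fam_L2 P, of "of_real a"]]
    have "(\<lambda>z. zonal r s z + of_real a * zonal ?P s z) \<in> L2_closure (disc_measure \<kappa> \<rho>) fam" .
    also have "(\<lambda>z. zonal r s z + of_real a * zonal ?P s z) = zonal q s"
      by (simp add: fun_eq_iff zonal_def r_def algebra_simps)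
    finally show ?case .
  qed simp
  then show ?thesis by blast
qed

lemma zonal_span_in_L2_closure: "f \<in> zonal_span \<Longrightarrow> f \<in> L2_closure (disc_measure \<kappa> \<rho>) fam"
  by (induction rule: zonal_span.induct)
    (simp_all add: zonal_in_L2_closure L2_closure_add[OF fam_L2] L2_closure_scale[OF fam_L2])

text \<open>
  Stone--Weierstrass on the cylinder, for the function \<open>(u, t) \<mapsto> \<phi> (u * sqrt t)\<close>. A uniform
  approximation is an approximation in mean square as the measure is finite.
\<close>
lemma continuous_in_L2_closure:
  fixes \<phi> :: "complex \<Rightarrow> real"
  assumes "continuous_on UNIV \<phi>"
  shows "(\<lambda>z. of_real (\<phi> z)) \<in> L2_closure (disc_measure \<kappa> \<rho>) fam"
proof (rule L2_closure_approx[OF fam_L2])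
  let ?M = "disc_measure \<kappa> \<rho>"
  interpret finite_measure ?M by (rule finite_measure_disc_measure[OF \<kappa> \<rho>])
  have m: "(\<lambda>z. of_real (\<phi> z) :: complex) \<in> borel_measurable ?M"
    using assms by (intro borel_measurable_disc_measureI borel_measurable_continuous_onI continuous_intros)
  have "compact (\<phi> ` cball 0 1)"
    by (intro compact_continuous_image continuous_on_subset[OF assms]) auto
  from compact_imp_bounded[OF this] obtain B where "\<forall>x\<in>\<phi> ` cball 0 1. norm x \<le> B"
    unfolding bounded_iff by blast
  then have B: "\<bar>\<phi> z\<bar> \<le> B" if "z \<in> cball 0 1" for z
    using that by simp
  show L2: "(\<lambda>z. of_real (\<phi> z)) \<in> L2_space ?M"
    by (rule L2_space_bounded[OF finite_measure_axioms m, of B]) (auto intro!: AE_I2 B)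
  fix \<epsilon> :: real assume "\<epsilon> > 0"
  \<comment> \<open>The uniform error \<open>\<delta>\<close> costs \<open>\<delta>\<^sup>2\<close> times the total mass, which has to stay below \<open>\<epsilon>\<close>; the
    summand 1 keeps the denominator positive.\<close>
  define \<delta> where "\<delta> = sqrt (\<epsilon> / (measure ?M (space ?M) + 1))"
  have pos: "measure ?M (space ?M) + 1 > 0" by (intro add_nonneg_pos) auto
  then have \<delta>: "\<delta> > 0" "\<delta>\<^sup>2 = \<epsilon> / (measure ?M (space ?M) + 1)"
    using \<open>\<epsilon> > 0\<close> by (auto simp: \<delta>_def)
  define F where "F = (\<lambda>(u, t). \<phi> (u * of_real (sqrt t)))"
  have "continuous_on (sphere 0 1 \<times> {0..1}) F"
    unfolding F_def case_prod_unfold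
    by (intro continuous_on_compose2[OF assms] continuous_intros) auto
  moreover have "compact (sphere (0::complex) 1 \<times> {0..1::real})"
    by (intro compact_Times) auto
  ultimately obtain p where p: "real_polynomial_function p"
    "\<And>x. x \<in> sphere 0 1 \<times> {0..1} \<Longrightarrow> \<bar>F x - p x\<bar> < \<delta>"
    using Stone_Weierstrass_real_polynomial_function \<delta>(1) by metis
  let ?g = "\<lambda>z. of_real (p (direction z, (cmod z)\<^sup>2)) * zonal 1 0 z"
  have g: "?g \<in> L2_closure ?M fam"
    by (intro zonal_span_in_L2_closure zonal_span_times_polynomial p(1) zonal_span.zonal)
  have le: "(cmod (of_real (\<phi> z) - ?g z))\<^sup>2 \<le> \<delta>\<^sup>2" if "z \<in> space ?M" for z
  proof -
    have "direction z * of_real (cmod z) = z" by (simp add: direction_def sgn_eq)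
    then have F: "F (direction z, (cmod z)\<^sup>2) = \<phi> z" by (simp add: F_def)
    have "(direction z, (cmod z)\<^sup>2) \<in> sphere 0 1 \<times> {0..1}"
      using that by (auto simp: power_le_one)
    from p(2)[OF this] have "\<bar>\<phi> z - p (direction z, (cmod z)\<^sup>2)\<bar> \<le> \<delta>"
      unfolding F by simp
    moreover have "of_real (\<phi> z) - ?g z = of_real (\<phi> z - p (direction z, (cmod z)\<^sup>2))"
      by (simp add: zonal_def)
    ultimately show ?thesis by (simp only: norm_of_real power_mono abs_ge_zero)
  qed
  have "(LINT z|?M. (cmod (of_real (\<phi> z) - ?g z))\<^sup>2) \<le> (LINT z|?M. \<delta>\<^sup>2)"
  proof (rule integral_mono[OF _ _ le])
    show "integrable ?M (\<lambda>z. (cmod (of_real (\<phi> z) - ?g z))\<^sup>2)"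
      using L2_space_diff[OF L2, of ?g] g by (simp add: L2_closure_def L2_space_def)
  qed auto
  also have "\<dots> = measure ?M (space ?M) * (\<epsilon> / (measure ?M (space ?M) + 1))"
    by (simp add: \<delta>(2))
  also have "\<dots> < \<epsilon>" using pos \<open>\<epsilon> > 0\<close> by (simp add: field_simps)
  finally show "\<exists>g\<in>L2_closure ?M fam. (LINT z|?M. (cmod (of_real (\<phi> z) - g z))\<^sup>2) < \<epsilon>"
    using g by (intro bexI[of _ ?g])
qed

lemma complete_upsilon: "complete_system (disc_measure \<kappa> \<rho>) fam"
proof (rule complete_systemI)
  have "ball 0 1 \<in> sets (borel :: complex measure)" by simp
  then show "L2_space (disc_measure \<kappa> \<rho>) \<subseteq> L2_closure (disc_measure \<kappa> \<rho>) fam"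
    by (rule L2_closure_eq_L2_spaceI_continuous[where e = fam, OF fam_L2
          finite_measure_disc_measure[OF \<kappa> \<rho>] sets_disc_measure])
      (rule continuous_in_L2_closure)
qed (rule fam_L2)

end

theorem theorem3p23:
  fixes \<kappa> \<rho> :: real
  assumes "\<kappa> > -1" and "\<rho> > -1" and "\<rho> \<notin> \<int>"
  shows "orthogonal_system (disc_measure \<kappa> \<rho>) (\<lambda>(m::nat, s::int). upsilon \<kappa> \<rho> m s) \<and>
         complete_system (disc_measure \<kappa> \<rho>) (\<lambda>(m::nat, s::int). upsilon \<kappa> \<rho> m s)"
proof
  show "orthogonal_system (disc_measure \<kappa> \<rho>) (\<lambda>(m::nat, s::int). upsilon \<kappa> \<rho> m s)"
    unfolding orthogonal_system_def
  proof (intro conjI allI impI)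
    fix i j :: "nat \<times> int"
    let ?e = "\<lambda>(m::nat, s::int). upsilon \<kappa> \<rho> m s"
    obtain m s m' s' where ij: "i = (m, s)" "j = (m', s')" by (cases i, cases j) blast
    show "?e i \<in> L2_space (disc_measure \<kappa> \<rho>)" "L2_norm (disc_measure \<kappa> \<rho>) (?e i) \<noteq> 0"
      unfolding ij using upsilon_L2[OF assms(1,2)] L2_norm_upsilon_nonzero[OF assms(1,2)] by simp_all
    assume "i \<noteq> j"
    then show "L2_inner (disc_measure \<kappa> \<rho>) (?e i) (?e j) = 0"
      unfolding ij using L2_inner_upsilon[OF assms(1,2)] by simp
  qed
qed (rule complete_upsilon[OF assms(1,2)])

end
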